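(* Let $(X,\mathscr M,\mu)$ be a semi-finite nontrivial measure space, $\mathscr A$ a basis in $X$, and $c_*\ge 1$. Assume that for every nonnegative $g\in L^\infty(X)$ and each real $t$ with $0<t<\mu(X)$ for which $\gamma:=\frac1t\int_0^t g^*(s)\,ds>0$, the basis $\mathscr A$ admits a $c_*$-Calderón-Zygmund decomposition for $g$ at level $\gamma$. If $f\in \mathrm{BMO}(X)$ (with respect to $\mathscr A$) is rearrangeable, then $f^*$ is locally integrable on $(0,\mu(X))$ and $$\|f^*\|_{\mathrm{BMO}}\le c_*\,\|f\|_{\mathrm{BMO}},$$ where the left-hand seminorm is that of $\mathrm{BMO}(0,\mu(X))$ and the right-hand one that of $\mathrm{BMO}(X)$.
   Context: Decreasing rearrangement: for a real-valued measurable $f$ on $(X,\mathscr M,\mu)$, let $\mu_f(\alpha)=\mu(\{x\in X:|f(x)|>\alpha\})$ for $\alpha\ge 0$. The function $f$ is rearrangeable if $\mu_f(\alpha)\to 0$ as $\alpha\to\infty$. Its decreasing rearrangement is $f^*(s)=\inf\{\alpha\ge 0:\mu_f(\alpha)\le s\}$, regarded as a function of $s\in(0,\mu(X))$. Mean oscillation: for $f$ integrable on $A\in\mathscr M$ with $0<\mu(A)<\infty$, $f_A=\frac1{\mu(A)}\int_A f\,d\mu$ and $\Omega(f,A)=\frac1{\mu(A)}\int_A|f-f_A|\,d\mu$. A basis $\mathscr A$ in $X$ is a collection $\mathscr A\subset\mathscr M$ of sets with $0<\mu(A)<\infty$ whose union is $X$. A real-valued measurable function $f$ that is integrable on every $A\in\mathscr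 A$ belongs to $\mathrm{BMO}(X)$ if $\|f\|_{\mathrm{BMO}}:=\sup_{A\in\mathscr A}\Omega(f,A)<\infty$. On an open interval in $\mathbb R$, the measure is Lebesgue measure and the basis is the collection of all non-empty bounded open subintervals; "locally integrable" on such an interval means integrable on each of these bounded open subintervals. Calderón-Zygmund decomposition: for a nonnegative measurable function $f$ on $X$ and $c_*\ge 1$, the basis $\mathscr A$ admits a $c_*$-Calderón-Zygmund decomposition for $f$ at level $\gamma>0$ if there exist a pairwise-disjoint sequence $\{A_i\}\subset\mathscr A$ and a corresponding sequence $\{\widetilde A_i\}\subset\mathscr A$ (finite, possibly empty, or countably infinite) such that (i) for all $i$, $\widetilde A_i\supset A_i$ and $\mu(\widetilde A_i)\le c_*\mu(A_i)$; (ii) for all $i$, $f$ is integrable on $\widetilde A_i$ and $f_{\widetilde A_i}\le\gamma\le f_{A_i}$; (iii) $f\le\gamma$ almost everywhere on $X\setminus\bigcup_i\widetilde A_i$. *)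

theory Defs
  imports "HOL-Analysis.Analysis"
begin

text \<open>The library locale \<open>semifinite_measure\<close> does not require the subset to have positive
  measure, so the empty set always witnesses it and it holds for every measure.\<close>

definition semi_finite :: "'a measure \<Rightarrow> bool" where
  "semi_finite M \<longleftrightarrow>
     (\<forall>A\<in>sets M. emeasure M A = \<infinity> \<longrightarrow>
        (\<exists>B\<in>sets M. B \<subseteq> A \<and> 0 < emeasure M B \<and> emeasure M B < \<infinity>))"

definition nontrivial_measure :: "'a measure \<Rightarrow> bool" where
  "nontrivial_measure M \<longleftrightarrow> 0 < emeasure M (space M)"

definition distribution_fun :: "'a measure \<Rightarrow> ('a \<Rightarrow> real) \<Rightarrow> real \<Rightarrow> ennreal" where
  "distribution_fun M f \<alpha> = emeasure M {x \<in> space M. \<bar>f x\<bar> > \<alpha>}"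

definition rearrangeable :: "'a measure \<Rightarrow> ('a \<Rightarrow> real) \<Rightarrow> bool" where
  "rearrangeable M f \<longleftrightarrow> f \<in> borel_measurable M \<and> (distribution_fun M f \<longlongrightarrow> 0) at_top"

text \<open>For a rearrangeable function and \<open>s > 0\<close> the set below is nonempty and bounded below by 0,
  so the infimum over the reals is the genuine one. For other arguments the value carries no
  meaning; the rearrangement is only ever used on \<open>rearr_dom M\<close>.\<close>

definition decr_rearr :: "'a measure \<Rightarrow> ('a \<Rightarrow> real) \<Rightarrow> real \<Rightarrow> real" where
  "decr_rearr M f s = Inf {\<alpha>. 0 \<le> \<alpha> \<and> distribution_fun M f \<alpha> \<le> ennreal s}"

text \<open>The interval \<open>(0, \<mu>(X))\<close>, where \<open>\<mu>(X)\<close> may be infinite.\<close>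

definition rearr_dom :: "'a measure \<Rightarrow> real set" where
  "rearr_dom M = {s. 0 < s \<and> ennreal s < emeasure M (space M)}"

definition measure_basis :: "'a measure \<Rightarrow> 'a set set \<Rightarrow> bool" where
  "measure_basis M \<A> \<longleftrightarrow>
     \<A> \<subseteq> sets M \<and> (\<forall>A\<in>\<A>. 0 < emeasure M A \<and> emeasure M A < \<infinity>) \<and> \<Union>\<A> = space M"

definition mean_on :: "'a measure \<Rightarrow> ('a \<Rightarrow> real) \<Rightarrow> 'a set \<Rightarrow> real" where
  "mean_on M f A = 1 / measure M A * (LINT x:A|M. f x)"

definition mean_osc :: "'a measure \<Rightarrow> ('a \<Rightarrow> real) \<Rightarrow> 'a set \<Rightarrow> real" where
  "mean_osc M f A = 1 / measure M A * (LINT x:A|M. \<bar>f x - mean_on M f A\<bar>)"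

definition integrable_on_sets :: "'a measure \<Rightarrow> 'a set set \<Rightarrow> ('a \<Rightarrow> real) \<Rightarrow> bool" where
  "integrable_on_sets M \<A> f \<longleftrightarrow> (\<forall>A\<in>\<A>. set_integrable M A f)"

text \<open>Only meaningful for \<open>f\<close> integrable on every member of \<open>\<A>\<close>, because the Bochner integral of
  a non-integrable function is 0.\<close>

definition bmo_seminorm :: "'a measure \<Rightarrow> 'a set set \<Rightarrow> ('a \<Rightarrow> real) \<Rightarrow> ennreal" where
  "bmo_seminorm M \<A> f = (SUP A\<in>\<A>. ennreal (mean_osc M f A))"

definition BMO :: "'a measure \<Rightarrow> 'a set set \<Rightarrow> ('a \<Rightarrow> real) set" where
  "BMO M \<A> =
     {f \<in> borel_measurable M. integrable_on_sets M \<A> f \<and> bmo_seminorm M \<A> f < \<infinity>}"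

definition bounded_open_subintervals :: "real set \<Rightarrow> real set set" where
  "bounded_open_subintervals J = {I. I \<subseteq> J \<and> (\<exists>a b. a < b \<and> I = {a<..<b})}"

definition L_infinity :: "'a measure \<Rightarrow> ('a \<Rightarrow> real) set" where
  "L_infinity M = {g \<in> borel_measurable M. \<exists>C. AE x in M. \<bar>g x\<bar> \<le> C}"

text \<open>The index set \<open>N\<close> is an arbitrary set of natural numbers, which covers finite, empty and
  countably infinite sequences alike.\<close>

definition admits_CZ_decomposition ::
    "'a measure \<Rightarrow> 'a set set \<Rightarrow> real \<Rightarrow> ('a \<Rightarrow> real) \<Rightarrow> real \<Rightarrow> bool" where
  "admits_CZ_decomposition M \<A> c f \<gamma> \<longleftrightarrow>
     (\<exists>(N :: nat set) (A :: nat \<Rightarrow> 'a set) (A' :: nat \<Rightarrow> 'a set).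
        (\<forall>i\<in>N. A i \<in> \<A> \<and> A' i \<in> \<A>) \<and>
        disjoint_family_on A N \<and>
        (\<forall>i\<in>N. A i \<subseteq> A' i \<and> emeasure M (A' i) \<le> ennreal c * emeasure M (A i)) \<and>
        (\<forall>i\<in>N. set_integrable M (A' i) f \<and>
                mean_on M f (A' i) \<le> \<gamma> \<and> \<gamma> \<le> mean_on M f (A i)) \<and>
        (AE x in M. x \<in> space M - (\<Union>i\<in>N. A' i) \<longrightarrow> f x \<le> \<gamma>))"

end

theory Submission
  imports Defs
begin

text \<open>
  For a decreasing function \<open>h\<close> with primitive \<open>F t = \<integral>\<^sub>0\<^sup>t h\<close>, the integral of the distance of \<open>h\<close>
  from its mean over \<open>(a, b)\<close> is twice the largest height of the concave function \<open>F\<close> above its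
  chord over \<open>(a, b)\<close> (\<open>mean_deviation_le\<close>). The bound on the seminorm therefore says that the primitive of
  the rearrangement of \<open>f\<close> exceeds none of its chords by more than \<open>c B / 2\<close> times the length of the
  chord's interval, where \<open>B\<close> is the seminorm of \<open>f\<close>.

  The primitive is accessible through convex duality. For bounded \<open>g \<ge> 0\<close> put
  \<open>P \<alpha> = \<integral> max (g - \<alpha>) 0\<close> over \<open>M\<close>. Since \<open>g\<close> and its rearrangement are equimeasurable, \<open>F t\<close> is the
  minimum of \<open>\<alpha> t + P \<alpha>\<close> over \<open>\<alpha> \<ge> 0\<close>, attained at the value of the rearrangement at \<open>t\<close>
  (\<open>F_le_excess\<close>, \<open>excess_at_rearr\<close>). Integrals over \<open>M\<close> and over the real line are compared through \<open>P\<close>.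

  For such a \<open>g\<close>, the chord over a head \<open>(0, t)\<close> has as slope \<open>\<gamma>\<close> the mean of the rearrangement, and
  the height above it is at most \<open>P \<gamma>\<close>. A decomposition at level \<open>\<gamma>\<close> covers the set where \<open>g > \<gamma>\<close>
  by sets on which \<open>g\<close> has mean at most \<open>\<gamma>\<close>, and the oscillation on these bounds \<open>P \<gamma>\<close>; their total
  measure is at most \<open>c t\<close>, unless \<open>P \<gamma> = 0\<close>, because the smaller disjoint sets have means at
  least \<open>\<gamma>\<close> (\<open>excess_le_of_CZ\<close>). If the measure is finite, the function \<open>K - g\<close> with \<open>K\<close> an upper bound of \<open>g\<close>
  treats tails in the same way (\<open>primitive_reflect\<close>). An arbitrary interval lies in a head or a
  tail with the same mean, and enlarging an interval with fixed mean does not decrease the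
  oscillation of a decreasing function (\<open>chord_gap_bounded_of_heads_and_tails\<close>).

  The rearrangement of \<open>f\<close> is that of \<open>|f|\<close>, whose mean oscillation on a set can come arbitrarily
  close to twice that of \<open>f\<close>. The factor is avoided by rearranging the positive and the
  negative part of \<open>f\<close> separately. Their oscillations do not exceed those of \<open>f\<close>, and the
  primitive for \<open>|f|\<close> is the sup-convolution of the two primitives, an operation which preserves
  the bound (\<open>chord_gap_bounded_supconvolution\<close>, \<open>chord_gap_bounded_sum\<close>).

  Finally \<open>f\<close> is truncated at height \<open>n\<close>. The bounds do not depend on \<open>n\<close>, and on heads
  \<open>(0, b)\<close> they bound the integrals of the truncated rearrangements, which makes the limit
  integrable (\<open>integrable_of_truncated_chord_gaps\<close>).
\<close>

section \<open>Chords of concave functions\<close>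

text \<open>For the primitive \<open>F\<close> of a decreasing function \<open>h\<close>, the largest value of \<open>chord_gap F a b\<close> on
  \<open>(a, b)\<close> is half of the integral of the distance of \<open>h\<close> from its mean over \<open>(a, b)\<close>. So a mean
  oscillation of at most \<open>D\<close> on \<open>(a, b)\<close> is the condition named \<open>chord_gap_bounded D F a b\<close> below.\<close>

definition chord_gap :: "(real \<Rightarrow> real) \<Rightarrow> real \<Rightarrow> real \<Rightarrow> real \<Rightarrow> real" where
  "chord_gap F a b x = F x - F a - (F b - F a) / (b - a) * (x - a)"

definition chord_gap_bounded :: "real \<Rightarrow> (real \<Rightarrow> real) \<Rightarrow> real \<Rightarrow> real \<Rightarrow> bool" where
  "chord_gap_bounded D F a b \<longleftrightarrow> (\<forall>x\<in>{a<..<b}. chord_gap F a b x \<le> D / 2 * (b - a))"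

lemma concave_three_points:
  fixes G :: "real \<Rightarrow> real"
  assumes "concave_on {0..} G" "0 \<le> a" "a < x" "x < b"
  shows "(b - x) * G a + (x - a) * G b \<le> (b - a) * G x"
proof -
  have ba: "b - a > 0" using assms by simp
  define u where "u = (x - a) / (b - a)"
  have u: "0 \<le> u" "u \<le> 1" "1 - u = (b - x) / (b - a)"
    using assms by (auto simp: u_def field_simps)
  have "u * (b - a) = x - a" using ba by (simp add: u_def)
  then have ux: "x = (1 - u) *\<^sub>R a + u *\<^sub>R b" by (simp add: algebra_simps)
  have "(1 - u) * G a + u * G b \<le> G x"
    using concave_onD[OF assms(1) u(1,2), of a b] assms ux by simp
  then have "(b - a) * ((1 - u) * G a + u * G b) \<le> (b - a) * G x"
    using ba by (intro mult_left_mono) auto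
  moreover have "(b - a) * ((1 - u) * G a + u * G b) = (b - x) * G a + (x - a) * G b"
  proof -
    have "(b - a) * (1 - u) = b - x" "(b - a) * u = x - a" using ba by (simp_all add: u(3)) (simp add: u_def)
    then show ?thesis by (simp add: distrib_left mult.assoc[symmetric])
  qed
  ultimately show ?thesis by simp
qed

text \<open>Subtracting a linear function changes no chord gap. This reduces every question about a chord
  to a horizontal one, that is, to a question about the levels of a concave function.\<close>

lemma concave_tilt:
  fixes F :: "real \<Rightarrow> real"
  assumes "concave_on {0..} F"
  shows "concave_on {0..} (\<lambda>s. F s - m * s)"
proof -
  have "convex_on {0..} (\<lambda>s::real. m * s)"
    by (auto simp: convex_on_def algebra_simps)
  with assms show ?thesis by (rule concave_on_diff)
qed

lemma chord_gap_tilt: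
  assumes "a < b"
  shows "chord_gap (\<lambda>s. F s - m * s) a b x = chord_gap F a b x"
proof -
  have "F b - m * b - (F a - m * a) = (F b - F a) - m * (b - a)" by algebra
  then have "(F b - m * b - (F a - m * a)) / (b - a) = (F b - F a) / (b - a) - m"
    using assms by (simp only: diff_divide_distrib[of "F b - F a"]) simp
  then have eq: "chord_gap (\<lambda>s. F s - m * s) a b x
      = F x - m * x - (F a - m * a) - ((F b - F a) / (b - a) - m) * (x - a)"
    unfolding chord_gap_def by simp
  define q where "q = (F b - F a) / (b - a)"
  show ?thesis unfolding eq unfolding chord_gap_def q_def[symmetric] by (simp add: algebra_simps)
qed

lemma chord_gap_level: "F a = F b \<Longrightarrow> chord_gap F a b x = F x - F a"
  by (simp add: chord_gap_def)

lemma chord_gap_endpoint: "a < b \<Longrightarrow> chord_gap F a b a = 0 \<and> chord_gap F a b b = 0"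
  by (simp add: chord_gap_def)

text \<open>A concave function that rises above a horizontal chord is strictly below it outside, and to the
  right it falls at least as fast as a line.\<close>

lemma concave_outside_chord:
  fixes G :: "real \<Rightarrow> real"
  assumes G: "concave_on {0..} G" and "0 \<le> a" "a < x" "x < b"
    and "G a = \<eta>" "G b = \<eta>" "G x > \<eta>"
  shows "b < s \<Longrightarrow> (b - x) * (G s - \<eta>) \<le> - (s - b) * (G x - \<eta>)"
    and "b < s \<Longrightarrow> G s < \<eta>" and "0 \<le> s \<Longrightarrow> s < a \<Longrightarrow> G s < \<eta>"
proof -
  show A: "(b - x) * (G s - \<eta>) \<le> - (s - b) * (G x - \<eta>)" if "b < s"
    using concave_three_points[OF G, of x b s] assms that by (simp add: algebra_simps)
  show "G s < \<eta>" if "b < s"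
  proof (rule ccontr)
    assume "\<not> G s < \<eta>"
    then have "(b - x) * (G s - \<eta>) \<ge> 0" "(s - b) * (G x - \<eta>) > 0" using assms that by auto
    with A[OF that] show False by linarith
  qed
  show "G s < \<eta>" if "0 \<le> s" "s < a"
  proof (rule ccontr)
    assume "\<not> G s < \<eta>"
    then have "(x - a) * (G s - \<eta>) \<ge> 0" "(a - s) * (G x - \<eta>) > 0" using assms that by auto
    moreover have "(x - a) * (G s - \<eta>) \<le> - (a - s) * (G x - \<eta>)"
      using concave_three_points[OF G, of s a x] assms that by (simp add: algebra_simps)
    ultimately show False by linarith
  qed
qed

text \<open>For concave functions, the gap above a horizontal chord divided by its length does not
  decrease when the interval is enlarged to another one with a horizontal chord. The secants from the left end to \<open>x\<close> and from \<open>x\<close> to the right end give one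
  inequality each, and the two add up to the claim.\<close>

lemma level_gap_mono:
  fixes G :: "real \<Rightarrow> real"
  assumes G: "concave_on {0..} G" and "0 \<le> a'" "a' \<le> a" "a < x" "x < b" "b \<le> b'"
    and "G a = G b" "G a' = G b'"
  shows "(G x - G a) * (b' - a') \<le> (G x - G a') * (b - a)"
proof -
  have "(G x - G a) * (x - a') \<le> (G x - G a') * (x - a)"
  proof (cases "a' = a")
    case False
    then show ?thesis using concave_three_points[OF G, of a' a x] assms by (simp add: algebra_simps)
  qed simp
  moreover have "(G x - G b) * (b' - x) \<le> (G x - G b') * (b - x)"
  proof (cases "b' = b")
    case False
    then show ?thesis using concave_three_points[OF G, of x b b'] assms by (simp add: algebra_simps)
  qed simp
  ultimately show ?thesis using assms by (simp add: algebra_simps)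
qed

lemma chord_gap_enlarge:
  fixes G :: "real \<Rightarrow> real"
  assumes G: "concave_on {0..} G" and "0 \<le> a'" "a' \<le> a" "a < x" "x < b" "b \<le> b'"
    and lev: "G a = G b" "G a' = G b'"
    and bd: "chord_gap_bounded D G a' b'"
  shows "chord_gap G a b x \<le> D / 2 * (b - a)"
proof -
  have "G x - G a' \<le> D / 2 * (b' - a')"
    using bd assms chord_gap_level[of G a' b', OF lev(2)] by (auto simp: chord_gap_bounded_def)
  then have "(G x - G a') * (b - a) \<le> D / 2 * (b' - a') * (b - a)"
    using assms by (intro mult_right_mono) auto
  with level_gap_mono[OF assms(1-8)]
  have "(G x - G a) * (b' - a') \<le> (D / 2 * (b - a)) * (b' - a')" by (simp add: algebra_simps)
  then have "G x - G a \<le> D / 2 * (b - a)" using assms by (auto simp: mult_le_cancel_right)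
  then show ?thesis using chord_gap_level[of G a b, OF lev(1)] by simp
qed

text \<open>The closed condition passes to the right end point. It is needed there because
  decompositions are available only for \<open>t < \<mu>(X)\<close>, while intervals may end at \<open>\<mu>(X)\<close>.\<close>

lemma chord_gap_bounded_left_limit:
  fixes F :: "real \<Rightarrow> real"
  assumes cont: "continuous_on {0..} F" and ab: "0 \<le> a" "a < b"
    and bd: "\<And>t. a < t \<Longrightarrow> t < b \<Longrightarrow> chord_gap_bounded D F a t"
  shows "chord_gap_bounded D F a b"
  unfolding chord_gap_bounded_def
proof
  fix x assume x: "x \<in> {a<..<b}"
  have "(F \<longlongrightarrow> F b) (at b within {0..})"
    using cont ab by (simp add: continuous_on_def)
  moreover have "at b within {0..} = at b"
    using ab by (intro at_within_interior) auto
  ultimately have Fb: "(F \<longlongrightarrow> F b) (at_left b)" using filterlim_at_split by auto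
  have lim: "((\<lambda>t. chord_gap F a t x) \<longlongrightarrow> chord_gap F a b x) (at_left b)"
    unfolding chord_gap_def using ab by (auto intro!: tendsto_intros Fb)
  have lim': "((\<lambda>t. D / 2 * (t - a)) \<longlongrightarrow> D / 2 * (b - a)) (at_left b)"
    by (intro tendsto_intros)
  have "eventually (\<lambda>t. t \<in> {x<..<b}) (at_left b)"
    using x by (intro eventually_at_leftI[of x]) auto
  then have ev: "eventually (\<lambda>t. chord_gap F a t x \<le> D / 2 * (t - a)) (at_left b)"
    by eventually_elim (use bd x in \<open>auto simp: chord_gap_bounded_def\<close>)
  show "chord_gap F a b x \<le> D / 2 * (b - a)"
    by (rule tendsto_le[OF _ lim' lim ev]) simp
qed

text \<open>Every interval is contained in a head \<open>(0, t)\<close> or a tail \<open>(s, l)\<close> whose chord has the same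
  slope, unless its gap is nowhere positive. After tilting, the chord over \<open>(a, b)\<close> lies at a level
  \<open>G a \<ge> 0 = G 0\<close>, and \<open>G\<close> decreases beyond \<open>b\<close>: either it reaches \<open>0\<close> at some \<open>t\<close>, or the domain
  ends at \<open>l\<close> with \<open>G l > 0\<close>, and then \<open>G\<close> takes the value \<open>G l\<close> at some \<open>s \<le> a\<close>. On an unbounded
  domain the first case always occurs, since \<open>G\<close> falls at least linearly.\<close>

lemma chord_gap_bounded_of_heads_and_tails:
  fixes F :: "real \<Rightarrow> real" and L :: ennreal
  assumes conc: "concave_on {0..} F" and cont: "continuous_on {0..} F" and F0: "F 0 = 0"
    and D: "0 \<le> D"
    and heads: "\<And>t. 0 < t \<Longrightarrow> ennreal t < L \<Longrightarrow> chord_gap_bounded D F 0 t"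
    and tails: "\<And>l s. L = ennreal l \<Longrightarrow> 0 < s \<Longrightarrow> s < l \<Longrightarrow> chord_gap_bounded D F s l"
    and ab: "0 \<le> a" "a < b" "ennreal b < L"
  shows "chord_gap_bounded D F a b"
  unfolding chord_gap_bounded_def
proof
  fix x assume x: "x \<in> {a<..<b}"
  define m where "m = (F b - F a) / (b - a)"
  define G where "G s = F s - m * s" for s
  have G: "concave_on {0..} G" unfolding G_def using conc by (rule concave_tilt)
  have contG: "continuous_on {0..} G" unfolding G_def by (intro continuous_intros cont)
  then have contG': "continuous_on S G" if "S \<subseteq> {0..}" for S
    using continuous_on_subset that by blast
  have G0: "G 0 = 0" by (simp add: G_def F0)
  have "m * (b - a) = F b - F a" using ab by (simp add: m_def)
  then have Gab: "G a = G b" by (simp add: G_def algebra_simps)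
  have gap: "chord_gap F p q y = chord_gap G p q y" if "p < q" for p q y
    unfolding G_def using chord_gap_tilt[OF that] by simp
  have bdd: "chord_gap_bounded D F p q = chord_gap_bounded D G p q" if "p < q" for p q
    unfolding chord_gap_bounded_def gap[OF that] ..
  show "chord_gap F a b x \<le> D / 2 * (b - a)"
  proof (cases "G x > G a")
    case False
    moreover have "0 \<le> D / 2 * (b - a)" using D ab by simp
    ultimately show ?thesis using gap[of a b x] ab chord_gap_level[of G a b x, OF Gab] by simp
  next
    case True
    have x': "a < x" "x < b" using x by auto
    note out = concave_outside_chord[OF G ab(1) x' refl Gab[symmetric] True]
    have Ga: "0 \<le> G a"
    proof (cases "a = 0")
      case False
      then show ?thesis using out(3)[of 0] ab G0 by simp
    qed (simp add: G0)
    have enlarge: ?thesis if "0 \<le> p" "p \<le> a" "b \<le> q" "G p = G q" "chord_gap_bounded D F p q" for p q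
    proof -
      have "p < q" using that ab by linarith
      then have "chord_gap G a b x \<le> D / 2 * (b - a)"
        using that ab x Gab bdd[of p q] by (intro chord_gap_enlarge[OF G, of p a x b q D]) auto
      then show ?thesis using gap[OF ab(2)] by simp
    qed
    have head: ?thesis if "b \<le> t" "ennreal t < L" "G t = 0" for t
      by (rule enlarge[of 0 t]) (use heads[of t] that ab G0 in auto)
    show ?thesis
    proof (cases L rule: ennreal_cases)
      case top
      define s where "s = b + (b - x) * G a / (G x - G a) + 1"
      have s: "b < s" using True Ga x by (simp add: s_def add_nonneg_pos)
      have "(s - b) * (G x - G a) = (b - x) * G a + (G x - G a)"
        using True by (simp add: s_def field_simps)
      then have "(b - x) * (G s - G a) \<le> - ((b - x) * G a + (G x - G a))"
        using out(1)[OF s] by linarith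
      then have "(b - x) * G s < 0" using True by (simp add: algebra_simps)
      then have "G s \<le> 0" using x by (simp add: mult_less_0_iff)
      then obtain t where "b \<le> t" "t \<le> s" "G t = 0"
        using IVT2'[of G s 0 b] s Ga Gab contG'[of "{b..s}"] ab by auto
      then show ?thesis using head top by simp
    next
      case (real l)
      have bl: "b < l" using ab real by (simp add: ennreal_less_iff)
      have Gl: "G l < G a" using out(2)[OF bl] .
      show ?thesis
      proof (cases "G l \<le> 0")
        case True
        obtain t where t: "b \<le> t" "t \<le> l" "G t = 0"
          using IVT2'[of G l 0 b] True Ga Gab contG'[of "{b..l}"] ab bl by auto
        show ?thesis
        proof (cases "t < l")
          case True
          then show ?thesis using head t ab real by (simp add: ennreal_less_iff)
        next
          case False
          then have tl: "t = l" using t by simp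
          have "chord_gap_bounded D F 0 l"
            by (rule chord_gap_bounded_left_limit[OF cont]) (use heads real bl ab in \<open>auto simp: ennreal_less_iff\<close>)
          then show ?thesis using enlarge[of 0 l] ab bl t tl G0 by simp
        qed
      next
        case False
        then obtain s where s: "0 \<le> s" "s \<le> a" "G s = G l"
          using IVT'[of G 0 "G l" a] Gl G0 contG'[of "{0..a}"] ab by auto
        then have "0 < s" using False G0 by (cases "s = 0") auto
        then show ?thesis using enlarge[of s l] tails[of l s] s real ab bl by simp
      qed
    qed
  qed
qed

section \<open>Sup-convolutions\<close>

text \<open>The primitive \<open>H\<close> of the rearrangement of \<open>|f|\<close> is the sup-convolution of those of the positive
  and the negative part, \<open>V\<close> and \<open>W\<close>, and the lemma says that this operation keeps the bound on
  the chord gaps with the same constant. After tilting by the slope of the chord of \<open>H\<close> over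
  \<open>(a, b)\<close>, let \<open>x1\<close> and \<open>x2\<close> make \<open>\<phi> x1 + \<psi> x2\<close> at least as large as the
  tilted \<open>H\<close> at \<open>x\<close>. Going back along the ray through \<open>(x1, x2)\<close> until the sum is at the level
  of the chord gives \<open>a1\<close> and \<open>a2\<close>; going forward in each coordinate separately until the value at \<open>a1\<close>, respectively \<open>a2\<close>, is reached
  again gives \<open>y1\<close> and \<open>y2\<close>. Then \<open>(a1, y1)\<close> and \<open>(a2, y2)\<close> are degenerate or have horizontal chords, and as
  \<open>H\<close> is at or above the level of its chord only inside \<open>[a, b]\<close>, their lengths sum to at most \<open>b - a\<close>.\<close>

lemma chord_gap_bounded_supconvolution:
  fixes H V W :: "real \<Rightarrow> real"
  assumes H: "concave_on {0..} H" "H 0 = 0"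
    and V: "continuous_on {0..} V" "V 0 = 0" and W: "continuous_on {0..} W" "W 0 = 0"
    and super: "\<And>y z. 0 \<le> y \<Longrightarrow> 0 \<le> z \<Longrightarrow> V y + W z \<le> H (y + z)"
    and D: "0 \<le> D"
    and gapV: "\<And>p q. 0 \<le> p \<Longrightarrow> p < q \<Longrightarrow> q \<le> b \<Longrightarrow> chord_gap_bounded D V p q"
    and gapW: "\<And>p q. 0 \<le> p \<Longrightarrow> p < q \<Longrightarrow> q \<le> b \<Longrightarrow> chord_gap_bounded D W p q"
    and ab: "0 \<le> a" "a < b"
    and split: "\<And>x. a < x \<Longrightarrow> x < b \<Longrightarrow> chord_gap H a b x > 0 \<Longrightarrow>
       \<exists>x1 x2. 0 \<le> x1 \<and> 0 \<le> x2 \<and> x1 + x2 \<le> b \<and> 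
         H x - (H b - H a) / (b - a) * x \<le> V x1 + W x2 - (H b - H a) / (b - a) * (x1 + x2)"
  shows "chord_gap_bounded D H a b"
  unfolding chord_gap_bounded_def
proof
  fix x assume x: "x \<in> {a<..<b}"
  define m where "m = (H b - H a) / (b - a)"
  define G where "G s = H s - m * s" for s
  define \<phi> where "\<phi> s = V s - m * s" for s
  define \<psi> where "\<psi> s = W s - m * s" for s
  have G: "concave_on {0..} G" unfolding G_def using H(1) by (rule concave_tilt)
  have "m * (b - a) = H b - H a" using ab by (simp add: m_def)
  then have Gab: "G b = G a" by (simp add: G_def algebra_simps)
  have gapG: "chord_gap H a b x = G x - G a"
    using chord_gap_tilt[OF ab(2), of H m x] chord_gap_level[of G a b x] Gab unfolding G_def by simp
  show "chord_gap H a b x \<le> D / 2 * (b - a)"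
  proof (cases "chord_gap H a b x > 0")
    case False
    moreover have "0 \<le> D / 2 * (b - a)" using D ab by simp
    ultimately show ?thesis by simp
  next
    case True
    then have Gx: "G x > G a" using gapG by simp
    have super': "\<phi> y + \<psi> z \<le> G (y + z)" if "0 \<le> y" "0 \<le> z" for y z
      using super[OF that] by (simp add: G_def \<phi>_def \<psi>_def algebra_simps)
    have right: "s \<le> b" if "G a \<le> G s" for s
      using concave_outside_chord(2)[OF G, of a x b "G a" s] ab x Gab Gx that by force
    have left: "a \<le> s" if "G a \<le> G s" "0 \<le> s" for s
      using concave_outside_chord(3)[OF G, of a x b "G a" s] ab x Gab Gx that by force
    have G0: "0 \<le> G a"
      using concave_outside_chord(3)[OF G, of a x b "G a" 0] ab x Gab Gx H(2)
      by (cases "a = 0") (auto simp: G_def)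
    obtain x1 x2 where x12: "0 \<le> x1" "0 \<le> x2" "x1 + x2 \<le> b" "G x \<le> \<phi> x1 + \<psi> x2"
      using split[of x] x True unfolding m_def[symmetric]
      by (auto simp: G_def \<phi>_def \<psi>_def algebra_simps)
    have x12b: "x1 + x2 < b"
      using super'[of x1 x2] x12 Gx Gab by (cases "x1 + x2 = b") auto
    have cont: "continuous_on {0..} \<phi>" "continuous_on {0..} \<psi>"
      unfolding \<phi>_def \<psi>_def by (intro continuous_intros V W)+
    have "continuous_on {0..1} (\<lambda>l. \<phi> (l * x1) + \<psi> (l * x2))"
      by (intro continuous_on_add continuous_on_compose2[OF cont(1)]
          continuous_on_compose2[OF cont(2)] continuous_intros) (use x12 in auto)
    then obtain l where l: "0 \<le> l" "l \<le> 1" "\<phi> (l * x1) + \<psi> (l * x2) = G a"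
      using IVT'[of "\<lambda>l. \<phi> (l * x1) + \<psi> (l * x2)" 0 "G a" 1] G0 x12 Gx V(2) W(2)
      by (auto simp: \<phi>_def \<psi>_def)
    define a1 a2 where "a1 = l * x1" and "a2 = l * x2"
    have a12: "0 \<le> a1" "a1 \<le> x1" "0 \<le> a2" "a2 \<le> x2" "\<phi> a1 + \<psi> a2 = G a"
      using l x12 by (auto simp: a1_def a2_def mult_left_le_one_le)
    \<comment> \<open>If the value at \<open>r\<close> is not above the one at \<open>p\<close>, the degenerate interval \<open>y = p\<close> does.\<close>
    have stop: "\<exists>y. \<theta> y = \<theta> p \<and> p \<le> y \<and> \<theta> r - \<theta> p \<le> D / 2 * (y - p)"
      if "0 \<le> p" "p \<le> r" "r < q" "q \<le> b" "\<theta> q \<le> \<theta> p" "continuous_on {0..} \<theta>"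
        and bd: "\<And>p q. 0 \<le> p \<Longrightarrow> p < q \<Longrightarrow> q \<le> b \<Longrightarrow> chord_gap_bounded D \<theta> p q"
      for \<theta> :: "real \<Rightarrow> real" and p q r
    proof (cases "\<theta> r \<le> \<theta> p")
      case True
      then show ?thesis by (intro exI[of _ p]) auto
    next
      case False
      have "continuous_on {r..q} \<theta>" using that continuous_on_subset[of _ \<theta>] by auto
      then obtain y where y: "r \<le> y" "y \<le> q" "\<theta> y = \<theta> p"
        using IVT2'[of \<theta> q "\<theta> p" r] False \<open>r < q\<close> \<open>\<theta> q \<le> \<theta> p\<close> by auto
      then have "p < r" "r < y" using False that by (auto simp: order.order_iff_strict)
      then have "chord_gap \<theta> p y r \<le> D / 2 * (y - p)"
        using bd[of p y] y that by (auto simp: chord_gap_bounded_def)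
      then show ?thesis using chord_gap_level[of \<theta> p y r] y \<open>p < r\<close> \<open>r < y\<close>
        by (intro exI[of _ y]) auto
    qed
    have tilt: "chord_gap_bounded D \<phi> p q" "chord_gap_bounded D \<psi> p q"
      if "0 \<le> p" "p < q" "q \<le> b" for p q
      using gapV[OF that] gapW[OF that] chord_gap_tilt[OF that(2)]
      unfolding \<phi>_def \<psi>_def by (simp_all add: chord_gap_bounded_def)
    \<comment> \<open>The forward search ends before \<open>b\<close>, since at \<open>b\<close> the sum is bounded by the level of the chord.\<close>
    have "\<phi> (b - a2) \<le> \<phi> a1"
      using super'[of "b - a2" a2] a12 x12 x12b Gab by simp
    then obtain y1 where y1: "\<phi> y1 = \<phi> a1" "a1 \<le> y1" "\<phi> x1 - \<phi> a1 \<le> D / 2 * (y1 - a1)"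
      using stop[of a1 x1 "b - a2" \<phi>] a12 x12b cont tilt(1) by auto
    have "\<psi> (b - a1) \<le> \<psi> a2"
      using super'[of a1 "b - a1"] a12 x12 x12b Gab by simp
    then obtain y2 where y2: "\<psi> y2 = \<psi> a2" "a2 \<le> y2" "\<psi> x2 - \<psi> a2 \<le> D / 2 * (y2 - a2)"
      using stop[of a2 x2 "b - a1" \<psi>] a12 x12b cont tilt(2) by auto
    have "y1 + y2 \<le> b" using super'[of y1 y2] y1 y2 a12 by (intro right) auto
    moreover have "a \<le> a1 + a2" using super'[of a1 a2] a12 by (intro left) auto
    ultimately have "(y1 - a1) + (y2 - a2) \<le> b - a" by simp
    then have "D / 2 * ((y1 - a1) + (y2 - a2)) \<le> D / 2 * (b - a)"
      using D by (intro mult_left_mono) auto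
    moreover have "G x - G a \<le> D / 2 * ((y1 - a1) + (y2 - a2))"
      unfolding distrib_left using y1 y2 x12 a12 by linarith
    ultimately show ?thesis using gapG by simp
  qed
qed

section \<open>Integrals of decreasing functions\<close>

definition primitive :: "(real \<Rightarrow> real) \<Rightarrow> real \<Rightarrow> real" where
  "primitive h t = (LINT s:{0<..<t}|lebesgue. h s)"

lemma primitive_diff:
  assumes int: "set_integrable lebesgue {0<..<b} h" and ab: "0 \<le> a" "a \<le> b"
  shows "primitive h b - primitive h a = (LINT s:{a<..<b}|lebesgue. h s)"
proof -
  have i: "set_integrable lebesgue {0<..<a} h" "set_integrable lebesgue {a<..<b} h"
    by (rule set_integrable_subset[OF int]; use ab in auto)+
  have "primitive h b = (LINT s:{0<..<a} \<union> {a<..<b}|lebesgue. h s)"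
    unfolding primitive_def by (rule set_integral_discrete_difference[of "{a}"]) (use ab in auto)
  also have "\<dots> = primitive h a + (LINT s:{a<..<b}|lebesgue. h s)"
    unfolding primitive_def by (rule set_integral_Un) (use i in auto)
  finally show ?thesis by simp
qed

lemma set_integrable_const_Ioo [simp]:
  fixes a b k :: real
  shows "set_integrable lebesgue {a<..<b} (\<lambda>_. k)"
  by (rule absolutely_integrable_on_const) simp

lemma set_integral_const_Ioo:
  fixes a b k :: real
  shows "a \<le> b \<Longrightarrow> (LINT s:{a<..<b}|lebesgue. k) = k * (b - a)"
  by (simp add: set_lebesgue_integral_def)

lemma primitive_diff_le:
  assumes "set_integrable lebesgue {0<..<b} h" "0 \<le> a" "a \<le> b"
    and "\<And>s. a < s \<Longrightarrow> s < b \<Longrightarrow> h s \<le> k"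
  shows "primitive h b - primitive h a \<le> k * (b - a)"
proof -
  have "(LINT s:{a<..<b}|lebesgue. h s) \<le> (LINT s:{a<..<b}|lebesgue. k)"
    by (rule set_integral_mono) (use assms in \<open>auto intro: set_integrable_subset[OF assms(1)]\<close>)
  then show ?thesis using primitive_diff[OF assms(1-3)] set_integral_const_Ioo[OF assms(3), of k] by simp
qed

lemma primitive_diff_ge:
  assumes "set_integrable lebesgue {0<..<b} h" "0 \<le> a" "a \<le> b"
    and "\<And>s. a < s \<Longrightarrow> s < b \<Longrightarrow> k \<le> h s"
  shows "k * (b - a) \<le> primitive h b - primitive h a"
proof -
  have "(LINT s:{a<..<b}|lebesgue. k) \<le> (LINT s:{a<..<b}|lebesgue. h s)"
    by (rule set_integral_mono) (use assms in \<open>auto intro: set_integrable_subset[OF assms(1)]\<close>)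
  then show ?thesis using primitive_diff[OF assms(1-3)] set_integral_const_Ioo[OF assms(3), of k] by simp
qed

lemma primitive_0 [simp]: "primitive h 0 = 0"
  by (simp add: primitive_def set_lebesgue_integral_def)

lemma primitive_supergradient:
  assumes anti: "antimono_on {0<..} h" and int: "\<And>T. set_integrable lebesgue {0<..<T} h"
    and "0 < t" "0 \<le> s"
  shows "primitive h s \<le> primitive h t + h t * (s - t)"
proof (cases "t \<le> s")
  case True
  have "primitive h s - primitive h t \<le> h t * (s - t)"
    by (rule primitive_diff_le) (use assms True in \<open>auto simp: monotone_on_def\<close>)
  then show ?thesis by simp
next
  case False
  have "h t * (t - s) \<le> primitive h t - primitive h s"
    by (rule primitive_diff_ge) (use assms False in \<open>auto simp: monotone_on_def\<close>)
  then show ?thesis by (simp add: algebra_simps)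
qed

lemma primitive_concave:
  assumes anti: "antimono_on {0<..} h" and int: "\<And>T. set_integrable lebesgue {0<..<T} h"
  shows "concave_on {0..} (primitive h)"
  unfolding concave_on_iff
proof (intro conjI ballI allI impI)
  show "convex {0::real..}" by simp
  fix x y u v :: real
  assume xy: "x \<in> {0..}" "y \<in> {0..}" and uv: "0 \<le> u" "0 \<le> v" "u + v = 1"
  define t where "t = u *\<^sub>R x + v *\<^sub>R y"
  show "u * primitive h x + v * primitive h y \<le> primitive h t"
  proof (cases "t = 0")
    case True
    then have "u * x = 0" "v * y = 0" using xy uv unfolding t_def
      by (simp_all add: add_nonneg_eq_0_iff)
    then have "u * primitive h x = 0" "v * primitive h y = 0" by auto
    then show ?thesis using True by (simp only: add_0 primitive_0)
  next
    case False
    then have t: "0 < t" using xy uv by (simp add: t_def less_le)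
    note sg = primitive_supergradient[OF anti int t]
    have "u * primitive h x + v * primitive h y
        \<le> u * (primitive h t + h t * (x - t)) + v * (primitive h t + h t * (y - t))"
      using sg[of x] sg[of y] xy uv by (intro add_mono mult_left_mono) auto
    also have "\<dots> = (u + v) * primitive h t + h t * (t - (u + v) * t)"
      by (simp add: t_def algebra_simps)
    finally show ?thesis using uv by simp
  qed
qed

lemma primitive_continuous:
  assumes int: "\<And>T. set_integrable lebesgue {0<..<T} h"
  shows "continuous_on {0..} (primitive h)"
proof -
  have eq: "primitive h t = integral {0..t} h" for t
    unfolding primitive_def using set_lebesgue_integral_eq_integral(2)[OF int]
    by (simp add: integral_open_interval_real)
  have io: "h integrable_on {0..T}" for T
    using set_lebesgue_integral_eq_integral(1)[OF int[of T]]
    by (simp add: integrable_on_open_interval_real)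
  have c: "continuous_on {0..T} (primitive h)" for T
    using indefinite_integral_continuous_1[OF io[of T]] by (simp add: eq)
  show ?thesis
    unfolding continuous_on_eq_continuous_within
  proof
    fix x :: real assume x: "x \<in> {0..}"
    have "continuous (at x within {0..x + 1}) (primitive h)"
      using c[of "x + 1"] x by (simp add: continuous_on_eq_continuous_within)
    moreover have "at x within {0..} = at x within {0..x + 1}"
      by (rule at_within_nhd[of x "{..<x + 1}"]) (use x in auto)
    ultimately show "continuous (at x within {0..}) (primitive h)" by simp
  qed
qed

lemma antimono_crossing:
  fixes h :: "real \<Rightarrow> real"
  assumes anti: "antimono_on {a<..<b} h" and "a \<le> b"
  obtains c where "a \<le> c" "c \<le> b" "\<And>s. a < s \<Longrightarrow> s < c \<Longrightarrow> h s > m" "\<And>s. c < s \<Longrightarrow> s < b \<Longrightarrow> h s \<le> m"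
proof -
  define S where "S = insert a {s. a < s \<and> s < b \<and> h s > m}"
  have S: "S \<noteq> {}" "bdd_above S" using assms(2) by (auto simp: S_def intro!: bdd_aboveI[of _ b])
  show ?thesis
  proof (rule that[of "Sup S"])
    show "a \<le> Sup S" by (rule cSup_upper[OF _ S(2)]) (simp add: S_def)
    show "Sup S \<le> b" by (rule cSup_least[OF S(1)]) (use assms(2) in \<open>auto simp: S_def\<close>)
    show "h s > m" if s: "a < s" "s < Sup S" for s
    proof -
      obtain r where "r \<in> S" "s < r" using less_cSupE[OF s(2) S(1)] by blast
      then have "a < r" "r < b" "h r > m" using s by (auto simp: S_def)
      moreover have "h r \<le> h s" using anti \<open>s < r\<close> \<open>r < b\<close> s by (auto simp: monotone_on_def)
      ultimately show ?thesis by simp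
    qed
    show "h s \<le> m" if s: "Sup S < s" "s < b" for s
    proof (rule ccontr)
      assume "\<not> h s \<le> m"
      moreover have "a < s" using s \<open>a \<le> Sup S\<close> by simp
      ultimately have "s \<in> S" using s by (simp add: S_def)
      then show False using cSup_upper[OF _ S(2), of s] s by simp
    qed
  qed
qed

text \<open>A decreasing function crosses its mean \<open>m\<close> once, at \<open>c\<close> say, so both the part of \<open>|h - m|\<close> left
  of \<open>c\<close> and the part right of \<open>c\<close> integrate to the height of the primitive above its chord at
  \<open>c\<close>.\<close>

lemma mean_deviation_le:
  assumes anti: "antimono_on {0<..} h" and int: "set_integrable lebesgue {0<..<b} h"
    and ab: "0 \<le> a" "a < b" and D: "0 \<le> D"
    and bd: "chord_gap_bounded D (primitive h) a b"
    and m: "m = (LINT s:{a<..<b}|lebesgue. h s) / (b - a)"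
  shows "(LINT s:{a<..<b}|lebesgue. \<bar>h s - m\<bar>) \<le> D * (b - a)"
proof -
  have "antimono_on {a<..<b} h" using anti ab by (auto simp: monotone_on_def)
  then obtain c where c: "a \<le> c" "c \<le> b"
    "\<And>s. a < s \<Longrightarrow> s < c \<Longrightarrow> h s > m" "\<And>s. c < s \<Longrightarrow> s < b \<Longrightarrow> h s \<le> m"
    using antimono_crossing[of a b h m] ab by auto
  have i: "set_integrable lebesgue {p<..<q} h" if "0 \<le> p" "q \<le> b" for p q
    by (rule set_integrable_subset[OF int]) (use that in auto)
  have "(LINT s:{a<..<b}|lebesgue. \<bar>h s - m\<bar>)
      = (LINT s:{a<..<c} \<union> {c<..<b}|lebesgue. \<bar>h s - m\<bar>)"
    by (rule set_integral_discrete_difference[of "{c}"]) (use c in auto)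
  also have "\<dots> = (LINT s:{a<..<c}|lebesgue. \<bar>h s - m\<bar>) + (LINT s:{c<..<b}|lebesgue. \<bar>h s - m\<bar>)"
    by (rule set_integral_Un) (use ab c i in \<open>auto intro!: set_integrable_abs\<close>)
  also have "(LINT s:{a<..<c}|lebesgue. \<bar>h s - m\<bar>) = (LINT s:{a<..<c}|lebesgue. h s - m)"
    by (rule set_lebesgue_integral_cong) (use c in \<open>auto simp: less_imp_le\<close>)
  also have "\<dots> = primitive h c - primitive h a - m * (c - a)"
    using i[of a c] primitive_diff[OF i, of c a] set_integral_const_Ioo[of a c m] ab c by simp
  also have "(LINT s:{c<..<b}|lebesgue. \<bar>h s - m\<bar>) = (LINT s:{c<..<b}|lebesgue. m - h s)"
    by (rule set_lebesgue_integral_cong) (use c in auto)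
  also have "\<dots> = m * (b - c) - (primitive h b - primitive h c)"
    using i[of c b] primitive_diff[OF i, of b c] set_integral_const_Ioo[of c b m] ab c by simp
  also have "primitive h c - primitive h a - m * (c - a) + (m * (b - c) - (primitive h b - primitive h c))
      = 2 * chord_gap (primitive h) a b c"
  proof -
    have me: "m = (primitive h b - primitive h a) / (b - a)"
      unfolding m using primitive_diff[OF i, of b a] ab by simp
    then have "m * (b - a) = primitive h b - primitive h a" using ab by simp
    moreover have "chord_gap (primitive h) a b c = primitive h c - primitive h a - m * (c - a)"
      unfolding chord_gap_def me ..
    ultimately show ?thesis by (simp add: algebra_simps)
  qed
  also have "chord_gap (primitive h) a b c \<le> D / 2 * (b - a)"
  proof (cases "c = a \<or> c = b")
    case True
    then have "chord_gap (primitive h) a b c = 0" using chord_gap_endpoint[OF ab(2)] by auto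
    then show ?thesis using D ab by simp
  next
    case False
    then show ?thesis using bd c by (simp add: chord_gap_bounded_def)
  qed
  finally show ?thesis by simp
qed

section \<open>Equimeasurable functions\<close>

text \<open>Integrating the distribution function from \<open>\<alpha>\<close> upwards gives the excess. It replaces the
  distribution function in most computations below, because it is dual to the primitive of the
  rearrangement.\<close>

definition excess :: "'a measure \<Rightarrow> ('a \<Rightarrow> real) \<Rightarrow> real \<Rightarrow> ennreal" where
  "excess M g \<alpha> = (\<integral>\<^sup>+x. ennreal (g x - \<alpha>) \<partial>M)"

text \<open>The number of dyadic levels \<open>k / 2 ^ n\<close> with \<open>1 \<le> k \<le> 4 ^ n\<close> below \<open>y\<close>, times the step: an
  increasing approximation of \<open>max 0 y\<close> that is a finite combination of indicators of
  superlevel sets.\<close>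

definition staircase :: "nat \<Rightarrow> real \<Rightarrow> real" where
  "staircase n y = real (min (4 ^ n) (nat (\<lceil>2 ^ n * y\<rceil> - 1))) / 2 ^ n"

lemma staircase_eq_sum:
  "staircase n y = (\<Sum>k<4 ^ n. indicator {z. (real k + 1) / 2 ^ n < z} y / 2 ^ n)"
proof -
  have cnt: "(\<Sum>k<N. indicator {z. (real k + 1) / 2 ^ n < z} y) = real (min N (nat (\<lceil>2 ^ n * y\<rceil> - 1)))" for N
  proof (induction N)
    case (Suc N)
    have "(real N + 1) / 2 ^ n < y \<longleftrightarrow> real N + 1 < 2 ^ n * y" by (simp add: field_simps)
    also have "\<dots> \<longleftrightarrow> int N + 1 < \<lceil>2 ^ n * y\<rceil>" by (simp add: less_ceiling_iff)
    also have "\<dots> \<longleftrightarrow> N < nat (\<lceil>2 ^ n * y\<rceil> - 1)" by linarith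
    finally show ?case using Suc by (auto simp: indicator_def)
  qed simp
  show ?thesis by (simp add: staircase_def sum_divide_distrib[symmetric] cnt)
qed

lemma staircase_mono: "incseq (\<lambda>n. staircase n y)"
proof (rule incseq_SucI)
  fix n
  define c d where "c = nat (\<lceil>2 ^ n * y\<rceil> - 1)" and "d = nat (\<lceil>2 ^ Suc n * y\<rceil> - 1)"
  have "2 * c \<le> d"
  proof (cases "\<lceil>2 ^ n * y\<rceil> \<le> 1")
    case False
    have "of_int (\<lceil>2 ^ n * y\<rceil> - 1) < 2 ^ n * y" by linarith
    then have "of_int (2 * (\<lceil>2 ^ n * y\<rceil> - 1)) < 2 ^ Suc n * y" by simp
    then have "2 * (\<lceil>2 ^ n * y\<rceil> - 1) < \<lceil>2 ^ Suc n * y\<rceil>" by (simp only: less_ceiling_iff)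
    with False have "int (2 * c) \<le> \<lceil>2 ^ Suc n * y\<rceil> - 1" by (simp add: c_def)
    then show ?thesis unfolding d_def by linarith
  qed (simp add: c_def)
  then have "2 * min (4 ^ n) c \<le> min (4 ^ Suc n) d" by auto
  then have "real (2 * min (4 ^ n) c) / 2 ^ Suc n \<le> real (min (4 ^ Suc n) d) / 2 ^ Suc n"
    by (intro divide_right_mono of_nat_mono) auto
  then show "staircase n y \<le> staircase (Suc n) y"
    unfolding staircase_def c_def[symmetric] d_def[symmetric] by simp
qed

lemma staircase_tendsto: "(\<lambda>n. staircase n y) \<longlonglongrightarrow> max 0 y"
proof (cases "y \<le> 0")
  case True
  have "\<lceil>2 ^ n * y\<rceil> \<le> 1" for n using True mult_nonneg_nonpos[of "2 ^ n" y] by (simp add: ceiling_le_iff)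
  then have "staircase n y = 0" for n by (simp add: staircase_def)
  then show ?thesis using True by (simp add: max_def)
next
  case False
  obtain n0 where n0: "y \<le> 2 ^ n0"
    using real_arch_pow[of 2 y] by (auto intro: less_imp_le)
  have bounds: "y - 1 / 2 ^ n \<le> staircase n y \<and> staircase n y \<le> y" if n: "n \<ge> n0" for n
  proof -
    have "y \<le> 2 ^ n" using n0 power_increasing[OF n, of "2::real"] by linarith
    then have "2 ^ n * y \<le> 2 ^ n * 2 ^ n" by simp
    then have "\<lceil>2 ^ n * y\<rceil> \<le> 2 ^ n * 2 ^ n" by (simp add: ceiling_le_iff)
    also have "\<dots> = int (4 ^ n)" by (simp add: power_mult_distrib[symmetric])
    finally have "nat (\<lceil>2 ^ n * y\<rceil> - 1) \<le> 4 ^ n" by linarith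
    moreover have "0 < 2 ^ n * y" using False by simp
    then have "1 \<le> \<lceil>2 ^ n * y\<rceil>" by linarith
    ultimately have st: "staircase n y = (of_int \<lceil>2 ^ n * y\<rceil> - 1) / 2 ^ n"
      by (simp add: staircase_def min_absorb2)
    have "2 ^ n * y - 1 \<le> of_int \<lceil>2 ^ n * y\<rceil> - 1" "of_int \<lceil>2 ^ n * y\<rceil> - 1 \<le> 2 ^ n * y" by linarith+
    then have "(2 ^ n * y - 1) / 2 ^ n \<le> staircase n y" "staircase n y \<le> (2 ^ n * y) / 2 ^ n"
      unfolding st by (intro divide_right_mono; simp)+
    then show ?thesis by (simp add: diff_divide_distrib)
  qed
  have "(\<lambda>n. y - 1 / 2 ^ n) \<longlonglongrightarrow> y"
    using tendsto_diff[OF tendsto_const[of y] LIMSEQ_divide_realpow_zero[of 2 1]] by simp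
  then have "(\<lambda>n. staircase n y) \<longlonglongrightarrow> y"
    by (rule tendsto_sandwich[OF _ _ _ tendsto_const, rotated 2])
       (rule eventually_sequentiallyI[of n0], use bounds in blast)+
  then show ?thesis using False by simp
qed

text \<open>The integral of a staircase is a finite sum of measures of superlevel sets, and monotone
  convergence does the rest. This avoids exchanging two integrals, for which \<open>\<sigma>\<close>-finiteness
  would be the natural hypothesis.\<close>

lemma excess_eqI:
  assumes g[measurable]: "g \<in> borel_measurable M" and h[measurable]: "h \<in> borel_measurable N"
    and eq: "\<And>r. \<alpha> \<le> r \<Longrightarrow> emeasure M {x \<in> space M. r < g x} = emeasure N {x \<in> space N. r < h x}"
  shows "excess M g \<alpha> = excess N h \<alpha>"
proof -
  have int: "(\<integral>\<^sup>+x. ennreal (staircase n (f x - \<alpha>)) \<partial>R)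
      = (\<Sum>k<4 ^ n. ennreal (1 / 2 ^ n) * emeasure R {x \<in> space R. \<alpha> + (real k + 1) / 2 ^ n < f x})"
    if [measurable]: "f \<in> borel_measurable R" for R :: "'z measure" and f n
  proof -
    have "(\<integral>\<^sup>+x. ennreal (staircase n (f x - \<alpha>)) \<partial>R)
        = (\<integral>\<^sup>+x. (\<Sum>k<4 ^ n. ennreal (1 / 2 ^ n) * indicator {x \<in> space R. \<alpha> + (real k + 1) / 2 ^ n < f x} x) \<partial>R)"
    proof (rule nn_integral_cong)
      fix x assume x: "x \<in> space R"
      have "ennreal (staircase n (f x - \<alpha>))
        = (\<Sum>k<4 ^ n. ennreal (indicator {z. (real k + 1) / 2 ^ n < z} (f x - \<alpha>) / 2 ^ n))"
        unfolding staircase_eq_sum by (rule sum_ennreal[symmetric]) simp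
      also have "\<dots> = (\<Sum>k<4 ^ n. ennreal (1 / 2 ^ n) * indicator {x \<in> space R. \<alpha> + (real k + 1) / 2 ^ n < f x} x)"
        by (rule sum.cong) (use x in \<open>auto simp: indicator_def\<close>)
      finally show "ennreal (staircase n (f x - \<alpha>)) = \<dots>" .
    qed
    also have "\<dots> = (\<Sum>k<4 ^ n. \<integral>\<^sup>+x. ennreal (1 / 2 ^ n) * indicator {x \<in> space R. \<alpha> + (real k + 1) / 2 ^ n < f x} x \<partial>R)"
      by (rule nn_integral_sum) measurable
    also have "\<dots> = (\<Sum>k<4 ^ n. ennreal (1 / 2 ^ n) * emeasure R {x \<in> space R. \<alpha> + (real k + 1) / 2 ^ n < f x})"
      by (intro sum.cong refl nn_integral_cmult_indicator) measurable
    finally show ?thesis .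
  qed
  have [measurable]: "staircase n \<in> borel_measurable borel" for n
    unfolding staircase_def by measurable
  have lim: "(\<lambda>n. \<integral>\<^sup>+x. ennreal (staircase n (f x - \<alpha>)) \<partial>R) \<longlonglongrightarrow> excess R f \<alpha>"
    if [measurable]: "f \<in> borel_measurable R" for R :: "'z measure" and f
    unfolding excess_def
  proof (rule nn_integral_LIMSEQ)
    show "incseq (\<lambda>n x. ennreal (staircase n (f x - \<alpha>)))"
      using staircase_mono by (auto simp: incseq_def le_fun_def intro!: ennreal_leI)
    fix x
    have "(\<lambda>n. ennreal (staircase n (f x - \<alpha>))) \<longlonglongrightarrow> ennreal (max 0 (f x - \<alpha>))"
      by (intro tendsto_ennrealI staircase_tendsto)
    then show "(\<lambda>n. ennreal (staircase n (f x - \<alpha>))) \<longlonglongrightarrow> ennreal (f x - \<alpha>)"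
      by (simp add: max_def ennreal_neg split: if_splits)
  qed measurable
  have "(\<integral>\<^sup>+x. ennreal (staircase n (g x - \<alpha>)) \<partial>M) = (\<integral>\<^sup>+x. ennreal (staircase n (h x - \<alpha>)) \<partial>N)" for n
    unfolding int[OF g] int[OF h] by (intro sum.cong refl arg_cong2[where f = "(*)"] eq) auto
  then show ?thesis using LIMSEQ_unique[OF lim[OF g]] lim[OF h] by simp
qed

section \<open>The decreasing rearrangement\<close>

lemma borel_measurable_lebesgueI:
  "f \<in> borel_measurable borel \<Longrightarrow> f \<in> borel_measurable lebesgue"
  by (rule measurable_completion) simp

lemma distribution_fun_antimono:
  assumes [measurable]: "f \<in> borel_measurable M" and "\<alpha> \<le> \<beta>"
  shows "distribution_fun M f \<beta> \<le> distribution_fun M f \<alpha>"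
  unfolding distribution_fun_def by (rule emeasure_mono) (use assms in auto)

lemma decr_rearr_nonneg:
  assumes "\<beta> \<ge> 0" "distribution_fun M f \<beta> \<le> ennreal s"
  shows "0 \<le> decr_rearr M f s"
  unfolding decr_rearr_def by (rule cInf_greatest) (use assms in auto)

text \<open>The infimum is attained because the distribution function is continuous from the right: the
  set of points where \<open>|f| > \<alpha>\<close> is the increasing union of those where
  \<open>|f| > \<alpha> + 1 / (n + 1)\<close>. All properties of the rearrangement follow from this equivalence.\<close>

lemma decr_rearr_le_iff:
  assumes f[measurable]: "f \<in> borel_measurable M"
    and ne: "\<beta> \<ge> 0" "distribution_fun M f \<beta> \<le> ennreal s" and \<alpha>: "0 \<le> \<alpha>"
  shows "decr_rearr M f s \<le> \<alpha> \<longleftrightarrow> distribution_fun M f \<alpha> \<le> ennreal s"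
proof
  let ?S = "{\<alpha>. 0 \<le> \<alpha> \<and> distribution_fun M f \<alpha> \<le> ennreal s}"
  assume le: "decr_rearr M f s \<le> \<alpha>"
  have "distribution_fun M f (\<alpha> + 1 / real (Suc n)) \<le> ennreal s" for n
  proof -
    have "Inf ?S < \<alpha> + 1 / real (Suc n)"
      using le unfolding decr_rearr_def by (rule le_less_trans) simp
    then obtain r where "r \<in> ?S" "r < \<alpha> + 1 / real (Suc n)"
      using ne cInf_lessD[of ?S] by blast
    then show ?thesis
      using distribution_fun_antimono[OF f, of r "\<alpha> + 1 / real (Suc n)"] by (simp, meson order_trans)
  qed
  moreover have "distribution_fun M f \<alpha> = (SUP n. distribution_fun M f (\<alpha> + 1 / real (Suc n)))"
  proof -
    have "{x \<in> space M. \<alpha> < \<bar>f x\<bar>} = (\<Union>n. {x \<in> space M. \<alpha> + 1 / real (Suc n) < \<bar>f x\<bar>})" (is "_ = (\<Union>n. ?E n)")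
    proof safe
      fix x assume x: "x \<in> space M" "\<alpha> < \<bar>f x\<bar>"
      then obtain n where "1 / real (Suc n) < \<bar>f x\<bar> - \<alpha>"
        using nat_approx_posE[of "\<bar>f x\<bar> - \<alpha>"] by auto
      then show "x \<in> (\<Union>n. ?E n)" using x by (auto intro!: exI[of _ n])
    next
      fix x n assume "\<alpha> + 1 / real (Suc n) < \<bar>f x\<bar>"
      moreover have "0 < 1 / real (Suc n)" by simp
      ultimately show "\<alpha> < \<bar>f x\<bar>" by linarith
    qed
    moreover have "incseq ?E"
    proof (rule incseq_SucI, safe)
      fix x n assume "\<alpha> + 1 / real (Suc n) < \<bar>f x\<bar>"
      moreover have "1 / real (Suc (Suc n)) \<le> 1 / real (Suc n)" by (simp add: frac_le)
      ultimately show "\<alpha> + 1 / real (Suc (Suc n)) < \<bar>f x\<bar>" by linarith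
    qed
    ultimately show ?thesis
      unfolding distribution_fun_def by (subst SUP_emeasure_incseq) auto
  qed
  ultimately show "distribution_fun M f \<alpha> \<le> ennreal s" by (simp add: SUP_le_iff)
next
  assume "distribution_fun M f \<alpha> \<le> ennreal s"
  then show "decr_rearr M f s \<le> \<alpha>"
    unfolding decr_rearr_def using \<alpha> by (intro cInf_lower bdd_belowI[of _ 0]) auto
qed

locale bounded_nonneg =
  fixes M :: "'a measure" and g :: "'a \<Rightarrow> real" and K :: real
  assumes measurable [measurable]: "g \<in> borel_measurable M"
    and nonneg: "x \<in> space M \<Longrightarrow> 0 \<le> g x"
    and bound: "x \<in> space M \<Longrightarrow> g x \<le> K"
    and K: "0 \<le> K"
begin

abbreviation "h \<equiv> decr_rearr M g"
abbreviation "F \<equiv> primitive h"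

lemma distribution_eq: "0 \<le> \<alpha> \<Longrightarrow> distribution_fun M g \<alpha> = emeasure M {x \<in> space M. \<alpha> < g x}"
  unfolding distribution_fun_def using nonneg by (intro arg_cong[where f = "emeasure M"]) force

lemma distribution_K: "distribution_fun M g K = 0"
proof -
  have "{x \<in> space M. K < g x} = {}" using bound by force
  then show ?thesis unfolding distribution_eq[OF K] by (simp only: emeasure_empty)
qed

lemma rearr_le_iff: "0 \<le> \<alpha> \<Longrightarrow> h s \<le> \<alpha> \<longleftrightarrow> distribution_fun M g \<alpha> \<le> ennreal s"
  by (rule decr_rearr_le_iff[OF measurable K]) (simp_all add: distribution_K)

lemma rearr_nonneg: "0 \<le> h s"
  by (rule decr_rearr_nonneg[OF K]) (simp add: distribution_K)

lemma rearr_le: "h s \<le> K"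
  by (simp add: rearr_le_iff K distribution_K)

lemma rearr_antimono: "s \<le> t \<Longrightarrow> h t \<le> h s"
proof -
  assume "s \<le> t"
  have "distribution_fun M g (h s) \<le> ennreal s" using rearr_le_iff[OF rearr_nonneg] by blast
  also have "\<dots> \<le> ennreal t" using \<open>s \<le> t\<close> by (rule ennreal_leI)
  finally show "h t \<le> h s" using rearr_le_iff[OF rearr_nonneg] by blast
qed

lemma rearr_antimono_on: "antimono_on {0<..} h"
  by (auto simp: monotone_on_def rearr_antimono)

lemma rearr_measurable [measurable]: "h \<in> borel_measurable borel"
proof -
  have "(\<lambda>s. - h s) \<in> borel_measurable borel"
    by (rule borel_measurable_mono) (simp add: mono_def rearr_antimono)
  then have "(\<lambda>s. - (- h s)) \<in> borel_measurable borel" by measurable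
  then show ?thesis by simp
qed

lemma rearr_integrable: "set_integrable lebesgue {0<..<T} h"
proof (rule set_integrable_bound[OF set_integrable_const_Ioo[of 0 T K]])
  show "set_borel_measurable lebesgue {0<..<T} h"
    unfolding set_borel_measurable_def by (rule borel_measurable_lebesgueI) measurable
  show "AE x in lebesgue. x \<in> {0<..<T} \<longrightarrow> norm (h x) \<le> norm K"
    using rearr_nonneg rearr_le K by auto
qed

lemma F_concave: "concave_on {0..} F"
  by (rule primitive_concave[OF rearr_antimono_on rearr_integrable])

lemma F_continuous: "continuous_on {0..} F"
  by (rule primitive_continuous[OF rearr_integrable])

lemmas F_supergradient = primitive_supergradient[OF rearr_antimono_on rearr_integrable]

lemma F_mono: "0 \<le> s \<Longrightarrow> s \<le> t \<Longrightarrow> F s \<le> F t"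
  using primitive_diff_ge[OF rearr_integrable, of s t 0] rearr_nonneg by simp

lemma F_nonneg: "0 \<le> t \<Longrightarrow> 0 \<le> F t"
  using F_mono[of 0 t] by simp

text \<open>Both functions have the same distribution above every level \<open>r \<ge> 0\<close>: the points \<open>s > 0\<close> with
  \<open>h s > r\<close> form the interval from \<open>0\<close> to the value of the distribution function at \<open>r\<close>. The
  auxiliary function in the proof is negative off the positive half-line, so that it has no
  points there above such a level.\<close>

lemma excess_rearr:
  assumes "0 \<le> \<alpha>"
  shows "excess M g \<alpha> = (\<integral>\<^sup>+s. ennreal (h s - \<alpha>) * indicator {0<..} s \<partial>lebesgue)"
proof -
  define h' where "h' s = (if s \<in> {0<..} then h s else -1)" for s
  have [measurable]: "h' \<in> borel_measurable lebesgue"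
    unfolding h'_def by (rule borel_measurable_lebesgueI) measurable
  have "excess M g \<alpha> = excess lebesgue h' \<alpha>"
  proof (rule excess_eqI)
    fix r assume r: "\<alpha> \<le> r"
    have "{s \<in> space lebesgue. r < h' s} = {s. 0 < s \<and> ennreal s < distribution_fun M g r}"
      using rearr_le_iff[of r] assms r by (auto simp: h'_def not_le[symmetric])
    also have "emeasure lebesgue \<dots> = distribution_fun M g r"
    proof (cases "distribution_fun M g r" rule: ennreal_cases)
      case top
      then have "{s. 0 < s \<and> ennreal s < distribution_fun M g r} = {0<..}" by auto
      moreover have "emeasure lborel {0::real<..} = \<infinity>"
      proof (cases "emeasure lborel {0::real<..}" rule: ennreal_cases)
        case (real r)
        have "emeasure lborel {0<..<r + 1} \<le> emeasure lborel {0::real<..}"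
          by (rule emeasure_mono) auto
        with real show ?thesis by simp
      qed simp
      ultimately show ?thesis using top by simp
    next
      case (real d)
      then have "{s. 0 < s \<and> ennreal s < distribution_fun M g r} = {0<..<d}"
        by (auto simp: ennreal_less_iff)
      then show ?thesis using real by simp
    qed
    finally show "emeasure M {x \<in> space M. r < g x} = emeasure lebesgue {s \<in> space lebesgue. r < h' s}"
      using assms r by (simp add: distribution_eq)
  qed measurable
  also have "\<dots> = (\<integral>\<^sup>+s. ennreal (h s - \<alpha>) * indicator {0<..} s \<partial>lebesgue)"
    unfolding excess_def by (rule nn_integral_cong) (use assms in \<open>auto simp: h'_def ennreal_neg\<close>)
  finally show ?thesis .
qed

lemma F_eq:
  assumes "0 \<le> t"
  shows "F t - \<alpha> * t = (LINT s:{0<..<t}|lebesgue. h s - \<alpha>)"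
  using assms rearr_integrable set_integral_const_Ioo[of 0 t \<alpha>] by (simp add: primitive_def)

text \<open>Together with the equality at \<open>\<alpha> = h t\<close> in \<open>excess_at_rearr\<close> below, this expresses \<open>F t\<close> as the
  minimum of \<open>\<alpha> t + excess M g \<alpha>\<close> over \<open>\<alpha> \<ge> 0\<close>.\<close>

lemma F_le_excess:
  assumes "0 \<le> t" "0 \<le> \<alpha>"
  shows "ennreal (F t - \<alpha> * t) \<le> excess M g \<alpha>"
proof -
  have i: "set_integrable lebesgue {0<..<t} (\<lambda>s. h s - \<alpha>)" using rearr_integrable by simp
  have i': "set_integrable lebesgue {0<..<t} (\<lambda>s. max 0 (h s - \<alpha>))"
  proof (rule set_integrable_bound[OF set_integrable_abs[OF i]])
    show "set_borel_measurable lebesgue {0<..<t} (\<lambda>s. max 0 (h s - \<alpha>))"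
      unfolding set_borel_measurable_def by (rule borel_measurable_lebesgueI) measurable
  qed auto
  have "F t - \<alpha> * t \<le> (LINT s:{0<..<t}|lebesgue. max 0 (h s - \<alpha>))"
    unfolding F_eq[OF assms(1)] by (rule set_integral_mono[OF i i']) simp
  then have "ennreal (F t - \<alpha> * t) \<le> ennreal (LINT s:{0<..<t}|lebesgue. max 0 (h s - \<alpha>))"
    by (rule ennreal_leI)
  also have "\<dots> = (\<integral>\<^sup>+s. ennreal (indicator {0<..<t} s * max 0 (h s - \<alpha>)) \<partial>lebesgue)"
    unfolding set_lebesgue_integral_def real_scaleR_def
    by (rule nn_integral_eq_integral[symmetric]) (use i' in \<open>auto simp: set_integrable_def\<close>)
  also have "\<dots> \<le> (\<integral>\<^sup>+s. ennreal (h s - \<alpha>) * indicator {0<..} s \<partial>lebesgue)"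
    by (rule nn_integral_mono) (auto simp: indicator_def max_def ennreal_neg)
  finally show ?thesis using excess_rearr[OF assms(2)] by simp
qed

text \<open>If \<open>h\<close> crosses the level \<open>\<alpha>\<close> at \<open>t\<close>, then the positive part of \<open>h - \<alpha>\<close> lives on \<open>(0, t)\<close>. Two
  levels with this property matter: \<open>\<alpha> = h t\<close>, and any \<open>\<alpha>\<close> with \<open>t\<close> the measure of the set where
  \<open>g > \<alpha>\<close>.\<close>

lemma excess_eq_F:
  assumes "0 \<le> t" "0 \<le> \<alpha>"
    and above: "\<And>s. 0 < s \<Longrightarrow> s < t \<Longrightarrow> \<alpha> \<le> h s" and below: "\<And>s. t < s \<Longrightarrow> h s \<le> \<alpha>"
  shows "excess M g \<alpha> = ennreal (F t - \<alpha> * t)" "0 \<le> F t - \<alpha> * t"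
proof -
  have i: "set_integrable lebesgue {0<..<t} (\<lambda>s. h s - \<alpha>)" using rearr_integrable by simp
  have "AE s in lebesgue. s \<noteq> t" 
    by (rule AE_I'[of "{t}"]) auto
  then have "excess M g \<alpha> = (\<integral>\<^sup>+s. ennreal (indicator {0<..<t} s * (h s - \<alpha>)) \<partial>lebesgue)"
    unfolding excess_rearr[OF assms(2)]
    by (intro nn_integral_cong_AE, eventually_elim) (use below assms(1) in \<open>auto simp: indicator_def ennreal_neg\<close>)
  also have "\<dots> = ennreal (LINT s:{0<..<t}|lebesgue. h s - \<alpha>)"
    unfolding set_lebesgue_integral_def real_scaleR_def
    by (rule nn_integral_eq_integral) (use i above in \<open>auto simp: set_integrable_def indicator_def\<close>)
  finally show "excess M g \<alpha> = ennreal (F t - \<alpha> * t)" using F_eq[OF assms(1)] by simp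
  show "0 \<le> F t - \<alpha> * t"
    unfolding F_eq[OF assms(1)] unfolding set_lebesgue_integral_def
    by (rule Bochner_Integration.integral_nonneg) (use above in \<open>auto simp: indicator_def\<close>)
qed

lemma excess_at_rearr:
  assumes "0 \<le> t"
  shows "excess M g (h t) = ennreal (F t - h t * t)" "0 \<le> F t - h t * t"
  by (rule excess_eq_F; use assms in \<open>auto simp: rearr_nonneg rearr_antimono\<close>)+

lemma excess_at_distribution:
  assumes "0 \<le> m" and x: "distribution_fun M g m = ennreal x" "0 \<le> x"
  shows "excess M g m = ennreal (F x - m * x)" "0 \<le> F x - m * x"
proof -
  have "m \<le> h s" if "0 < s" "s < x" for s
    using rearr_le_iff[OF assms(1), of s] x that by (simp add: ennreal_le_iff not_le)
  moreover have "h s \<le> m" if "x < s" for s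
    using rearr_le_iff[OF assms(1), of s] x that by (simp add: ennreal_leI)
  ultimately show "excess M g m = ennreal (F x - m * x)" "0 \<le> F x - m * x"
    using excess_eq_F[OF x(2) assms(1)] by blast+
qed

text \<open>The hypothesis says that \<open>\<gamma>\<close> is a lower bound for the mean of \<open>h\<close> over the longer interval
  \<open>(0, T)\<close>, although it is the mean over \<open>(0, t)\<close>. For a decreasing \<open>h\<close> this forces \<open>h = \<gamma>\<close> on
  \<open>(0, t)\<close>. The proof reads this off from the optimal level \<open>\<alpha> = h t\<close>.\<close>

lemma excess_zero_of_balanced:
  assumes t: "0 < t" "F t = \<gamma> * t" and T: "t < T"
    and le: "\<And>\<alpha>. 0 \<le> \<alpha> \<Longrightarrow> ennreal (\<gamma> * T) \<le> ennreal (\<alpha> * T) + excess M g \<alpha>"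
  shows "excess M g \<gamma> = 0"
proof -
  let ?\<beta> = "h t"
  have e: "excess M g ?\<beta> = ennreal ((\<gamma> - ?\<beta>) * t)" "0 \<le> (\<gamma> - ?\<beta>) * t"
    using excess_at_rearr[of t] t by (simp_all add: algebra_simps)
  have \<gamma>: "?\<beta> \<le> \<gamma>" using e(2) t by (simp add: zero_le_mult_iff)
  have "ennreal (\<gamma> * T) \<le> ennreal (?\<beta> * T + (\<gamma> - ?\<beta>) * t)"
    using le[OF rearr_nonneg, of t] e t T rearr_nonneg by (simp add: ennreal_plus)
  then have "\<gamma> * T \<le> ?\<beta> * T + (\<gamma> - ?\<beta>) * t"
    using e(2) rearr_nonneg t T by (subst (asm) ennreal_le_iff) (auto intro!: add_nonneg_nonneg)
  then have "(\<gamma> - ?\<beta>) * (T - t) \<le> 0" by (simp add: algebra_simps)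
  then have "\<gamma> = ?\<beta>" using \<gamma> T by (auto simp: mult_le_0_iff)
  then show ?thesis using e(1) by simp
qed

lemma nn_integral_le_excess:
  assumes [measurable]: "S \<in> sets M" and "0 \<le> \<alpha>"
  shows "(\<integral>\<^sup>+x\<in>S. ennreal (g x) \<partial>M) \<le> ennreal \<alpha> * emeasure M S + excess M g \<alpha>"
proof -
  have "(\<integral>\<^sup>+x\<in>S. ennreal (g x) \<partial>M) \<le> (\<integral>\<^sup>+x. ennreal \<alpha> * indicator S x + ennreal (g x - \<alpha>) \<partial>M)"
  proof (rule nn_integral_mono)
    fix x
    have "ennreal (g x) \<le> ennreal (\<alpha> + max 0 (g x - \<alpha>))" by (rule ennreal_leI) simp
    also have "\<dots> = ennreal \<alpha> + ennreal (g x - \<alpha>)"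
      using assms(2) by (simp add: ennreal_plus max_def ennreal_neg)
    finally show "ennreal (g x) * indicator S x \<le> ennreal \<alpha> * indicator S x + ennreal (g x - \<alpha>)"
      by (auto simp: indicator_def)
  qed
  also have "\<dots> = ennreal \<alpha> * emeasure M S + excess M g \<alpha>"
    unfolding excess_def by (subst nn_integral_add) (auto simp: nn_integral_cmult_indicator)
  finally show ?thesis .
qed

end

section \<open>Mean oscillation\<close>

lemma set_integrable_max_const:
  assumes [measurable]: "f \<in> borel_measurable M" "A \<in> sets M" and "emeasure M A < \<infinity>" "set_integrable M A f"
  shows "set_integrable M A (\<lambda>x. max (f x) (k :: real))"
proof -
  have k: "set_integrable M A (\<lambda>_. k)"
    using assms by (simp add: set_integrable_def)
  have "set_integrable M A (\<lambda>x. \<bar>f x\<bar> + \<bar>k\<bar>)"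
    by (intro set_integral_add set_integrable_abs assms k)
  then show ?thesis
    by (rule set_integrable_bound) (auto simp: set_borel_measurable_def)
qed

lemma mean_deviation_zero:
  assumes "emeasure M A < \<infinity>" "0 < emeasure M A" "A \<in> sets M" "set_integrable M A f"
  shows "(LINT x:A|M. f x - mean_on M f A) = 0" and "set_integrable M A (\<lambda>_. k :: real)"
    and "0 < measure M A"
proof -
  show k: "set_integrable M A (\<lambda>_. k)" for k :: real
    using assms by (simp add: set_integrable_def)
  show A: "0 < measure M A" using assms by (simp add: measure_def enn2real_positive_iff)
  have "(LINT x:A|M. mean_on M f A) = mean_on M f A * measure M A"
    using assms by (simp add: set_lebesgue_integral_def)
  then show "(LINT x:A|M. f x - mean_on M f A) = 0"
    using A k assms by (simp add: mean_on_def)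
qed

lemma mean_osc_positive_part:
  assumes f[measurable]: "f \<in> borel_measurable M" and A[measurable]: "A \<in> sets M"
    and fin: "emeasure M A < \<infinity>" "0 < emeasure M A" and int: "set_integrable M A f"
  shows "measure M A * mean_osc M f A = 2 * (LINT x:A|M. max (f x - mean_on M f A) 0)"
proof -
  note z = mean_deviation_zero[OF fin A int]
  let ?m = "mean_on M f A"
  have d: "set_integrable M A (\<lambda>x. f x - ?m)" using int z(2) by (rule set_integral_diff)
  have "set_integrable M A (\<lambda>x. max (f x - ?m) 0)"
    by (rule set_integrable_max_const) (use d fin in auto)
  then have "(LINT x:A|M. 2 * max (f x - ?m) 0 - (f x - ?m)) = 2 * (LINT x:A|M. max (f x - ?m) 0)"
    using d z(1) by (subst set_integral_diff) auto
  moreover have "(\<lambda>x. 2 * max (f x - ?m) 0 - (f x - ?m)) = (\<lambda>x. \<bar>f x - ?m\<bar>)"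
    by (auto simp: fun_eq_iff max_def)
  ultimately show ?thesis using z(3) by (simp add: mean_osc_def)
qed

text \<open>The deviations above and below the mean have equal integrals, so the part above is half of the
  total, and raising the level from the mean to \<open>\<gamma>\<close> can only decrease it.\<close>

lemma mean_osc_bounds_excess:
  assumes f[measurable]: "f \<in> borel_measurable M" and A[measurable]: "A \<in> sets M"
    and fin: "emeasure M A < \<infinity>" "0 < emeasure M A" and int: "set_integrable M A f"
    and \<gamma>: "mean_on M f A \<le> \<gamma>"
  shows "2 * (LINT x:A|M. max (f x - \<gamma>) 0) \<le> measure M A * mean_osc M f A"
proof -
  note z = mean_deviation_zero[OF fin A int]
  have "(LINT x:A|M. max (f x - \<gamma>) 0) \<le> (LINT x:A|M. max (f x - mean_on M f A) 0)"
    by (rule set_integral_mono; (rule set_integrable_max_const)?) (use \<gamma> fin z int in auto)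
  then show ?thesis using mean_osc_positive_part[OF f A fin int] by simp
qed

lemma mean_osc_const_minus:
  assumes "A \<in> sets M" "emeasure M A < \<infinity>" "0 < emeasure M A" "set_integrable M A f"
  shows "mean_osc M (\<lambda>x. k - f x) A = mean_osc M f A"
proof -
  have "(LINT x:A|M. k) = k * measure M A" using assms by (simp add: set_lebesgue_integral_def)
  then have "mean_on M (\<lambda>x. k - f x) A = k - mean_on M f A"
    using mean_deviation_zero[of M A f] assms by (simp add: mean_on_def field_simps)
  then show ?thesis unfolding mean_osc_def by (simp add: abs_minus_commute)
qed

text \<open>Replacing \<open>f\<close> by \<open>max f k\<close> raises the mean to some \<open>m\<close> with \<open>m \<ge> k\<close>, and above the level \<open>m\<close> the
  two functions coincide.\<close>

lemma mean_osc_max_le: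
  assumes f[measurable]: "f \<in> borel_measurable M" and A[measurable]: "A \<in> sets M"
    and fin: "emeasure M A < \<infinity>" "0 < emeasure M A" and int: "set_integrable M A f"
  shows "mean_osc M (\<lambda>x. max (f x) k) A \<le> mean_osc M f A"
proof -
  note z = mean_deviation_zero[OF fin A int]
  have int': "set_integrable M A (\<lambda>x. max (f x) k)"
    by (rule set_integrable_max_const) (use fin int in auto)
  define m where "m = mean_on M (\<lambda>x. max (f x) k) A"
  have le: "r \<le> m" if "set_integrable M A u" "\<And>x. x \<in> A \<Longrightarrow> u x \<le> max (f x) k" "r = mean_on M u A" for u r
    unfolding m_def that(3) mean_on_def using set_integral_mono[OF that(1) int' that(2)] z(3)
    by (intro mult_left_mono) auto
  have mf: "mean_on M f A \<le> m" by (rule le[OF int]) auto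
  have "k = mean_on M (\<lambda>_. k) A" using z(3) fin by (simp add: mean_on_def set_lebesgue_integral_def)
  then have km: "k \<le> m" by (intro le[of "\<lambda>_. k"] z(2)) auto
  have "measure M A * mean_osc M (\<lambda>x. max (f x) k) A = 2 * (LINT x:A|M. max (max (f x) k - m) 0)"
    unfolding m_def by (rule mean_osc_positive_part) (use fin int' in auto)
  also have "\<dots> = 2 * (LINT x:A|M. max (f x - m) 0)"
    using km by (intro arg_cong[where f = "(*) 2"] set_lebesgue_integral_cong) auto
  also have "\<dots> \<le> measure M A * mean_osc M f A"
    by (rule mean_osc_bounds_excess[OF f A fin int mf])
  finally show ?thesis using z(3) by simp
qed

lemma mean_osc_min_le:
  assumes f[measurable]: "f \<in> borel_measurable M" and A[measurable]: "A \<in> sets M"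
    and fin: "emeasure M A < \<infinity>" "0 < emeasure M A" and int: "set_integrable M A f"
  shows "mean_osc M (\<lambda>x. min (f x) k) A \<le> mean_osc M f A"
proof -
  have int': "set_integrable M A (\<lambda>x. 0 - f x)"
    using int mean_deviation_zero(2)[OF fin A int, of 0] by (intro set_integral_diff)
  have "set_integrable M A (\<lambda>x. max (0 - f x) (- k))"
    by (rule set_integrable_max_const) (use fin int' in auto)
  then have "mean_osc M (\<lambda>x. 0 - max (0 - f x) (- k)) A = mean_osc M (\<lambda>x. max (0 - f x) (- k)) A"
    using fin A by (intro mean_osc_const_minus) auto
  also have "\<dots> \<le> mean_osc M (\<lambda>x. 0 - f x) A"
    by (rule mean_osc_max_le) (use fin int' in auto)
  also have "\<dots> = mean_osc M f A"
    by (rule mean_osc_const_minus) (use fin int in auto)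
  also have "(\<lambda>x. 0 - max (0 - f x) (- k)) = (\<lambda>x. min (f x) k)" by auto
  finally show ?thesis .
qed

section \<open>Calderon-Zygmund decompositions\<close>

context bounded_nonneg
begin

lemma set_integrable_finite:
  assumes [measurable]: "A \<in> sets M" and fin: "emeasure M A < \<infinity>"
  shows "set_integrable M A g"
proof -
  have "set_integrable M A (\<lambda>_. K)" using fin by (simp add: set_integrable_def)
  then show ?thesis
    by (rule set_integrable_bound)
       (use nonneg bound sets.sets_into_space[OF assms(1)] in \<open>force simp: set_borel_measurable_def\<close>)+
qed

lemma nn_set_integral_eq:
  assumes [measurable]: "A \<in> sets M" and fin: "emeasure M A < \<infinity>"
  shows "(\<integral>\<^sup>+x\<in>A. ennreal (g x - \<gamma>) \<partial>M) = ennreal (LINT x:A|M. max (g x - \<gamma>) 0)"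
proof -
  have "set_integrable M A (\<lambda>x. g x - \<gamma>)"
    using set_integrable_finite[OF assms] fin by (intro set_integral_diff) (auto simp: set_integrable_def)
  then have i: "set_integrable M A (\<lambda>x. max (g x - \<gamma>) 0)"
    using fin by (intro set_integrable_max_const) auto
  have "(\<integral>\<^sup>+x\<in>A. ennreal (g x - \<gamma>) \<partial>M) = (\<integral>\<^sup>+x. ennreal (indicator A x * max (g x - \<gamma>) 0) \<partial>M)"
    by (rule nn_integral_cong) (auto simp: indicator_def max_def ennreal_neg)
  also have "\<dots> = ennreal (LINT x:A|M. max (g x - \<gamma>) 0)"
    unfolding set_lebesgue_integral_def real_scaleR_def
    by (rule nn_integral_eq_integral) (use i in \<open>auto simp: set_integrable_def\<close>)
  finally show ?thesis .
qed

text \<open>Outside the large sets \<open>A' i\<close> the function stays below \<open>\<gamma>\<close>; on each of them its mean is at most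
  \<open>\<gamma>\<close>, so the part above \<open>\<gamma>\<close> is controlled by the oscillation. This bounds the excess by
  \<open>c * B / 2\<close> times the total measure of the small disjoint sets \<open>A i\<close>. On their union the mean of
  \<open>g\<close> is at least \<open>\<gamma>\<close>, and since the rearrangement has mean \<open>\<gamma>\<close> over \<open>(0, t)\<close>, the union has measure
  at most \<open>t\<close>, except when there is no excess over \<open>\<gamma>\<close> at all.\<close>

lemma excess_le_of_CZ:
  assumes basis: "measure_basis M \<A>" and cz: "admits_CZ_decomposition M \<A> c g \<gamma>"
    and c: "0 \<le> c" and B: "0 \<le> B" and osc: "\<And>A. A \<in> \<A> \<Longrightarrow> mean_osc M g A \<le> B"
    and \<gamma>: "0 < \<gamma>" and t: "0 < t" "F t = \<gamma> * t"
  shows "excess M g \<gamma> \<le> ennreal (c * B / 2 * t)"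
proof -
  obtain N :: "nat set" and A A' where
        mem: "\<And>i. i \<in> N \<Longrightarrow> A i \<in> \<A>" "\<And>i. i \<in> N \<Longrightarrow> A' i \<in> \<A>"
    and disj: "disjoint_family_on A N"
    and size: "\<And>i. i \<in> N \<Longrightarrow> emeasure M (A' i) \<le> ennreal c * emeasure M (A i)"
    and mean: "\<And>i. i \<in> N \<Longrightarrow> mean_on M g (A' i) \<le> \<gamma>" "\<And>i. i \<in> N \<Longrightarrow> \<gamma> \<le> mean_on M g (A i)"
    and out: "AE x in M. x \<in> space M - (\<Union>i\<in>N. A' i) \<longrightarrow> g x \<le> \<gamma>"
    using cz unfolding admits_CZ_decomposition_def by blast
  \<comment> \<open>Empty sets at the indices outside \<open>N\<close> turn the families into sequences.\<close>
  define E where "E i = (if i \<in> N then A' i else {})" for i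
  define G where "G i = (if i \<in> N then A i else {})" for i
  have basisD: "S \<in> sets M" "emeasure M S < \<infinity>" "0 < emeasure M S" if "S \<in> \<A>" for S
    using basis that by (auto simp: measure_basis_def)
  have [measurable]: "E i \<in> sets M" "G i \<in> sets M" for i
    using mem basisD by (auto simp: E_def G_def)
  have disjG: "disjoint_family G"
    using disj by (auto simp: disjoint_family_on_def G_def)
  have piece: "(\<integral>\<^sup>+x\<in>E i. ennreal (g x - \<gamma>) \<partial>M) \<le> ennreal (c * B / 2) * emeasure M (G i)" for i
  proof (cases "i \<in> N")
    case True
    note A' = basisD[OF mem(2)[OF True]]
    have "2 * (LINT x:A' i|M. max (g x - \<gamma>) 0) \<le> measure M (A' i) * mean_osc M g (A' i)"
      by (rule mean_osc_bounds_excess) (use A' set_integrable_finite mean True in auto)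
    also have "\<dots> \<le> measure M (A' i) * B"
      using osc[OF mem(2)[OF True]] by (intro mult_left_mono) auto
    finally have "(LINT x:A' i|M. max (g x - \<gamma>) 0) \<le> B / 2 * measure M (A' i)" by (simp add: mult.commute)
    then have "(\<integral>\<^sup>+x\<in>A' i. ennreal (g x - \<gamma>) \<partial>M) \<le> ennreal (B / 2 * measure M (A' i))"
      unfolding nn_set_integral_eq[OF A'(1,2)] by (rule ennreal_leI)
    also have "\<dots> = ennreal (B / 2) * emeasure M (A' i)"
      using A'(2) B by (simp add: ennreal_mult[symmetric] emeasure_eq_ennreal_measure)
    also have "\<dots> \<le> ennreal (B / 2) * (ennreal c * emeasure M (A i))"
      by (intro mult_left_mono size True) simp
    also have "\<dots> = ennreal (c * B / 2) * emeasure M (A i)"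
      using c B by (simp add: mult.assoc[symmetric] ennreal_mult[symmetric] mult.commute)
    finally show ?thesis using True by (simp add: E_def G_def)
  qed (simp add: E_def G_def)
  have "excess M g \<gamma> \<le> (\<integral>\<^sup>+x. (\<Sum>i. ennreal (g x - \<gamma>) * indicator (E i) x) \<partial>M)"
    unfolding excess_def
  proof (rule nn_integral_mono_AE)
    show "AE x in M. ennreal (g x - \<gamma>) \<le> (\<Sum>i. ennreal (g x - \<gamma>) * indicator (E i) x)"
      using out
    proof (rule AE_mp, intro AE_I2 impI)
      fix x assume x: "x \<in> space M" "x \<in> space M - (\<Union>i\<in>N. A' i) \<longrightarrow> g x \<le> \<gamma>"
      show "ennreal (g x - \<gamma>) \<le> (\<Sum>i. ennreal (g x - \<gamma>) * indicator (E i) x)"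
      proof (cases "x \<in> (\<Union>i\<in>N. A' i)")
        case True
        then obtain i where "i \<in> N" "x \<in> A' i" by auto
        then have "x \<in> E i" by (simp add: E_def)
        then have "ennreal (g x - \<gamma>) = (\<Sum>j\<in>{i}. ennreal (g x - \<gamma>) * indicator (E j) x)" by simp
        also have "\<dots> \<le> (\<Sum>i. ennreal (g x - \<gamma>) * indicator (E i) x)"
          by (rule sum_le_suminf) auto
        finally show ?thesis .
      qed (use x in \<open>simp add: ennreal_neg\<close>)
    qed
  qed
  also have "\<dots> = (\<Sum>i. \<integral>\<^sup>+x\<in>E i. ennreal (g x - \<gamma>) \<partial>M)"
    by (rule nn_integral_suminf) measurable
  also have "\<dots> \<le> (\<Sum>i. ennreal (c * B / 2) * emeasure M (G i))"
    by (intro suminf_le piece) auto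
  also have "\<dots> = ennreal (c * B / 2) * emeasure M (\<Union>i. G i)"
    using disjG by (subst ennreal_suminf_cmult, subst suminf_emeasure) auto
  finally have le: "excess M g \<gamma> \<le> ennreal (c * B / 2) * emeasure M (\<Union>i. G i)" .
  show ?thesis
  proof (cases "emeasure M (\<Union>i. G i) \<le> ennreal t")
    case True
    have "ennreal (c * B / 2) * emeasure M (\<Union>i. G i) \<le> ennreal (c * B / 2) * ennreal t"
      by (intro mult_left_mono True) simp
    also have "\<dots> = ennreal (c * B / 2 * t)" using c B t by (intro ennreal_mult[symmetric]) auto
    finally show ?thesis using le by (rule order_trans[rotated])
  next
    case False
    \<comment> \<open>The whole union may have infinite measure; finitely many of its members already exceed \<open>t\<close>.\<close>
    let ?S = "\<lambda>n. \<Union>i<n. G i"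
    have "(\<Union>i. G i) = (\<Union>n. ?S n)" by auto
    moreover have "incseq ?S" by (intro incseq_SucI) (auto simp: less_Suc_eq)
    ultimately have "emeasure M (\<Union>i. G i) = (SUP n. emeasure M (?S n))"
      by (subst SUP_emeasure_incseq) auto
    then obtain n where n: "ennreal t < emeasure M (?S n)"
      using False by (auto simp: not_le less_SUP_iff)
    have "emeasure M (?S n) \<le> (\<Sum>i<n. emeasure M (G i))" by (rule emeasure_subadditive_finite) auto
    also have "\<dots> < \<infinity>" using basisD mem by (auto simp: G_def)
    finally have fin: "emeasure M (?S n) = ennreal (measure M (?S n))"
      by (simp add: emeasure_eq_ennreal_measure)
    have "excess M g \<gamma> = 0"
    proof (rule excess_zero_of_balanced[OF t])
      show "t < measure M (?S n)" using n t unfolding fin by (simp add: ennreal_less_iff)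
      fix \<alpha> :: real assume \<alpha>: "0 \<le> \<alpha>"
      have disj': "disjoint_family_on G {..<n}"
        using disjG by (auto simp: disjoint_family_on_def)
      have ind: "indicator (?S n) x = (\<Sum>i<n. indicator (G i) x :: ennreal)" for x
        using indicator_UN_disjoint[OF _ disj'] by simp
      have "ennreal (\<gamma> * measure M (?S n)) = ennreal \<gamma> * emeasure M (?S n)"
        using \<gamma> by (simp add: fin ennreal_mult)
      also have "\<dots> = (\<Sum>i<n. ennreal \<gamma> * emeasure M (G i))"
        using disj' by (subst sum_emeasure[symmetric]) (auto simp: sum_distrib_left)
      also have "\<dots> \<le> (\<Sum>i<n. \<integral>\<^sup>+x\<in>G i. ennreal (g x) \<partial>M)"
      proof (rule sum_mono)
        fix i
        show "ennreal \<gamma> * emeasure M (G i) \<le> (\<integral>\<^sup>+x\<in>G i. ennreal (g x) \<partial>M)"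
        proof (cases "i \<in> N")
          case True
          note Ai = basisD[OF mem(1)[OF True]]
          have "0 < measure M (A i)" using Ai by (simp add: measure_def enn2real_positive_iff)
          then have "\<gamma> * measure M (A i) \<le> (LINT x:A i|M. g x)"
            using mean(2)[OF True] by (simp add: mean_on_def field_simps)
          also have "\<dots> = (LINT x:A i|M. max (g x - 0) 0)"
          proof (rule set_lebesgue_integral_cong[OF Ai(1)], intro allI impI)
            fix x assume "x \<in> A i"
            then show "g x = max (g x - 0) 0"
              using nonneg[of x] sets.sets_into_space[OF Ai(1)] by auto
          qed
          finally have "ennreal (\<gamma> * measure M (A i)) \<le> ennreal (LINT x:A i|M. max (g x - 0) 0)"
            by (rule ennreal_leI)
          then show ?thesis
            using nn_set_integral_eq[OF Ai(1,2), of 0] \<gamma> Ai(2) True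
            by (simp add: G_def ennreal_mult emeasure_eq_ennreal_measure)
        qed (simp add: G_def)
      qed
      also have "\<dots> = (\<integral>\<^sup>+x\<in>?S n. ennreal (g x) \<partial>M)"
        unfolding ind sum_distrib_left by (rule nn_integral_sum[symmetric]) measurable
      also have "\<dots> \<le> ennreal \<alpha> * emeasure M (?S n) + excess M g \<alpha>"
        by (rule nn_integral_le_excess) (use \<alpha> in auto)
      also have "\<dots> = ennreal (\<alpha> * measure M (?S n)) + excess M g \<alpha>"
        using \<alpha> by (simp add: fin ennreal_mult)
      finally show "ennreal (\<gamma> * measure M (?S n)) \<le> ennreal (\<alpha> * measure M (?S n)) + excess M g \<alpha>" .
    qed
    then show ?thesis by simp
  qed
qed

lemma head_gap:
  assumes basis: "measure_basis M \<A>" and c: "0 \<le> c" and B: "0 \<le> B"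
    and osc: "\<And>A. A \<in> \<A> \<Longrightarrow> mean_osc M g A \<le> B" and t: "0 < t"
    and cz: "0 < F t / t \<Longrightarrow> admits_CZ_decomposition M \<A> c g (F t / t)"
  shows "chord_gap_bounded (c * B) F 0 t"
  unfolding chord_gap_bounded_def
proof
  fix x assume x: "x \<in> {0<..<t}"
  have gap: "chord_gap F 0 t x = F x - F t / t * x" by (simp add: chord_gap_def)
  show "chord_gap F 0 t x \<le> c * B / 2 * (t - 0)"
  proof (cases "0 < F t / t")
    case True
    have "ennreal (F x - F t / t * x) \<le> excess M g (F t / t)"
      by (rule F_le_excess) (use x True in auto)
    also have "\<dots> \<le> ennreal (c * B / 2 * t)"
      by (rule excess_le_of_CZ[OF basis cz[OF True] c B osc True t(1)]) (use t in auto)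
    finally have "F x - F t / t * x \<le> c * B / 2 * t"
      using c B t by (subst (asm) ennreal_le_iff) auto
    then show ?thesis using gap by simp
  next
    case False
    then have "F t = 0" using F_nonneg[of t] t by (simp add: zero_less_divide_iff)
    moreover from this have "F x = 0" using F_mono[of x t] F_nonneg[of x] x by simp
    ultimately show ?thesis using c B t by (simp add: chord_gap_def)
  qed
qed

end

section \<open>Reflection\<close>

context bounded_nonneg
begin

lemma reflected: "bounded_nonneg M (\<lambda>x. K - g x) K"
  by unfold_locales (use nonneg bound K in auto)

text \<open>The rearrangement of \<open>K - g\<close> is that of \<open>g\<close> reversed and subtracted from \<open>K\<close>. In terms of
  primitives this follows by testing the minimum that equals the left-hand side at the level
  \<open>K - \<beta>\<close>, where \<open>\<beta>\<close> is optimal for \<open>g\<close> at \<open>l - t\<close>. The reverse inequality is the same statement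
  for \<open>K - g\<close>.\<close>

lemma primitive_reflect_le:
  assumes l: "emeasure M (space M) = ennreal l" and t: "0 \<le> t" "t \<le> l"
  shows "primitive (decr_rearr M (\<lambda>x. K - g x)) t \<le> K * t - (LINT x|M. g x) + F (l - t)"
proof -
  interpret R: bounded_nonneg M "\<lambda>x. K - g x" K by (rule reflected)
  interpret finite_measure M by (rule finite_measureI) (simp add: l)
  have ml: "measure M (space M) = l" using l t by (simp add: measure_def)
  have intg: "integrable M g"
    by (rule integrable_const_bound[of _ K]) (use nonneg bound in auto)
  define \<beta> where "\<beta> = h (l - t)"
  have \<beta>: "0 \<le> \<beta>" "\<beta> \<le> K" by (simp_all add: \<beta>_def rearr_nonneg rearr_le)
  have i: "integrable M (\<lambda>x. max (g x - \<beta>) 0)" "integrable M (\<lambda>x. max (\<beta> - g x) 0)"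
    by (rule integrable_const_bound[of _ K]; use nonneg bound \<beta> K in \<open>force intro!: AE_I2\<close>)+
  have "ennreal (LINT x|M. max (g x - \<beta>) 0) = excess M g \<beta>"
    unfolding excess_def
    by (subst nn_integral_eq_integral[symmetric, OF i(1)]) (auto intro!: nn_integral_cong simp: max_def ennreal_neg)
  also have "\<dots> = ennreal (F (l - t) - \<beta> * (l - t))"
    unfolding \<beta>_def using excess_at_rearr(1)[of "l - t"] t by simp
  finally have e1: "(LINT x|M. max (g x - \<beta>) 0) = F (l - t) - \<beta> * (l - t)"
    using excess_at_rearr(2)[of "l - t"] t by (simp add: \<beta>_def)
  have "ennreal (R.F t - (K - \<beta>) * t) \<le> excess M (\<lambda>x. K - g x) (K - \<beta>)"
    by (rule R.F_le_excess) (use t \<beta> in auto)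
  also have "\<dots> = ennreal (LINT x|M. max (\<beta> - g x) 0)"
    unfolding excess_def
    by (subst nn_integral_eq_integral[symmetric, OF i(2)]) (auto intro!: nn_integral_cong simp: max_def ennreal_neg)
  finally have e2: "R.F t - (K - \<beta>) * t \<le> (LINT x|M. max (\<beta> - g x) 0)"
    by (subst (asm) ennreal_le_iff) auto
  have "(LINT x|M. max (\<beta> - g x) 0) = (LINT x|M. max (g x - \<beta>) 0 + (\<beta> - g x))"
    by (rule Bochner_Integration.integral_cong) (auto simp: max_def)
  also have "\<dots> = (LINT x|M. max (g x - \<beta>) 0) + (\<beta> * l - (LINT x|M. g x))"
    using i intg by (simp add: ml mult.commute)
  finally show ?thesis using e1 e2 by (simp add: algebra_simps)
qed

lemma primitive_reflect:
  assumes l: "emeasure M (space M) = ennreal l" and t: "0 \<le> t" "t \<le> l"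
  shows "primitive (decr_rearr M (\<lambda>x. K - g x)) t = K * t - (LINT x|M. g x) + F (l - t)"
proof (rule antisym[OF primitive_reflect_le[OF assms]])
  interpret R: bounded_nonneg M "\<lambda>x. K - g x" K by (rule reflected)
  interpret finite_measure M by (rule finite_measureI) (simp add: l)
  have "measure M (space M) = l" using l t by (simp add: measure_def)
  moreover have intg: "integrable M g"
    by (rule integrable_const_bound[of _ K]) (use nonneg bound in auto)
  ultimately have "(LINT x|M. K - g x) = K * l - (LINT x|M. g x)" by (simp add: mult.commute)
  moreover have "F (l - t) \<le> K * (l - t) - (LINT x|M. K - g x) + R.F (l - (l - t))"
    using R.primitive_reflect_le[OF l, of "l - t"] t by simp
  ultimately show "K * t - (LINT x|M. g x) + F (l - t) \<le> R.F t"
    by (simp add: algebra_simps)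
qed

end

definition CZ_at_rearrangement_means :: "'a measure \<Rightarrow> 'a set set \<Rightarrow> real \<Rightarrow> bool" where
  "CZ_at_rearrangement_means M \<A> c \<longleftrightarrow>
     (\<forall>g t. g \<in> L_infinity M \<longrightarrow> (\<forall>x\<in>space M. 0 \<le> g x) \<longrightarrow> 0 < t \<longrightarrow> ennreal t < emeasure M (space M) \<longrightarrow>
        0 < primitive (decr_rearr M g) t / t \<longrightarrow>
        admits_CZ_decomposition M \<A> c g (primitive (decr_rearr M g) t / t))"

lemma chord_gap_reflect:
  assumes "a < b" and eq: "\<And>t. t \<in> {a, x, b} \<Longrightarrow> F t = C + k * t + R (l - t)"
  shows "chord_gap F a b x = chord_gap R (l - b) (l - a) (l - x)"
proof -
  define q where "q = (R (l - b) - R (l - a)) / (b - a)"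
  have q: "R (l - b) = R (l - a) + q * (b - a)" using assms(1) by (simp add: q_def)
  have "F b - F a = (k + q) * (b - a)" using eq[of a] eq[of b] q by (simp add: algebra_simps)
  then have slope: "(F b - F a) / (b - a) = k + q" using assms(1) by simp
  have slope': "(R (l - a) - R (l - b)) / (l - a - (l - b)) = - q"
    using q assms(1) by (simp add: field_simps)
  show ?thesis
    unfolding chord_gap_def slope slope' using eq[of a] eq[of x] q by (simp add: algebra_simps)
qed

lemma (in bounded_nonneg) in_L_infinity: "g \<in> L_infinity M"
  unfolding L_infinity_def using nonneg bound by (auto intro!: exI[of _ K] AE_I2)

text \<open>Decompositions for \<open>g\<close> give the bound on heads. If the measure is finite, those for \<open>K - g\<close>,
  which has the same oscillations, give it on tails.\<close>

lemma (in bounded_nonneg) chord_gap_bounded_nonneg: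
  assumes basis: "measure_basis M \<A>" and c: "0 \<le> c" and B: "0 \<le> B"
    and osc: "\<And>A. A \<in> \<A> \<Longrightarrow> mean_osc M g A \<le> B"
    and cz: "CZ_at_rearrangement_means M \<A> c"
    and ab: "0 \<le> a" "a < b" "ennreal b < emeasure M (space M)"
  shows "chord_gap_bounded (c * B) F a b"
proof (rule chord_gap_bounded_of_heads_and_tails[OF F_concave F_continuous _ _ _ _ ab])
  show "F 0 = 0" by simp
  show "0 \<le> c * B" using c B by simp
  show "chord_gap_bounded (c * B) F 0 t" if "0 < t" "ennreal t < emeasure M (space M)" for t
    by (rule head_gap[OF basis c B osc that(1)])
       (use cz that in_L_infinity nonneg in \<open>auto simp: CZ_at_rearrangement_means_def\<close>)
  show "chord_gap_bounded (c * B) F s l"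
    if l: "emeasure M (space M) = ennreal l" and s: "0 < s" "s < l" for l s
  proof -
    interpret R: bounded_nonneg M "\<lambda>x. K - g x" K by (rule reflected)
    have osc': "mean_osc M (\<lambda>x. K - g x) A \<le> B" if "A \<in> \<A>" for A
    proof -
      have A: "A \<in> sets M" "emeasure M A < \<infinity>" "0 < emeasure M A"
        using basis that by (auto simp: measure_basis_def)
      show ?thesis
        using mean_osc_const_minus[OF A set_integrable_finite[OF A(1,2)]] osc[OF that] by simp
    qed
    have "ennreal (l - s) < emeasure M (space M)" using l s by (simp add: ennreal_less_iff)
    then have head: "chord_gap_bounded (c * B) R.F 0 (l - s)"
      using s cz R.in_L_infinity R.nonneg
      by (intro R.head_gap[OF basis c B osc']) (auto simp: CZ_at_rearrangement_means_def)
    show ?thesis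
      unfolding chord_gap_bounded_def
    proof
      fix x assume x: "x \<in> {s<..<l}"
      have "F t = (LINT x|M. g x) - K * l + K * t + R.F (l - t)" if "t \<in> {s, x, l}" for t
        using primitive_reflect[OF l, of "l - t"] that x s by (auto simp: algebra_simps)
      then have "chord_gap F s l x = chord_gap R.F (l - l) (l - s) (l - x)"
        using s by (intro chord_gap_reflect) auto
      then show "chord_gap F s l x \<le> c * B / 2 * (l - s)"
        using head x by (auto simp: chord_gap_bounded_def)
    qed
  qed
qed

section \<open>Sums of functions with disjoint supports\<close>

lemma ennreal_add_le: "ennreal (u + v) \<le> ennreal u + ennreal v"
proof -
  have "ennreal (u + v) \<le> ennreal (max 0 u + max 0 v)" by (intro ennreal_leI) simp
  then show ?thesis by (simp add: ennreal_plus max_def ennreal_neg split: if_splits)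
qed

text \<open>As \<open>g1\<close> and \<open>g2\<close> do not overlap, distribution functions and excesses add. Hence the primitives
  satisfy the hypotheses of the lemma on sup-convolutions: superadditivity follows from the
  description of the primitive of the sum as a minimum, and the top above a chord of slope \<open>m\<close> is
  split at the measures of the sets where \<open>g1 > m\<close> and \<open>g2 > m\<close>.\<close>

lemma chord_gap_bounded_sum:
  assumes g1: "bounded_nonneg M g1 K" and g2: "bounded_nonneg M g2 K"
    and g: "bounded_nonneg M (\<lambda>x. g1 x + g2 x) K"
    and disj: "\<And>x. x \<in> space M \<Longrightarrow> g1 x = 0 \<or> g2 x = 0"
    and D: "0 \<le> D" and ab: "0 \<le> a" "a < b"
    and gap: "\<And>p q. 0 \<le> p \<Longrightarrow> p < q \<Longrightarrow> q \<le> b \<Longrightarrow> chord_gap_bounded D (primitive (decr_rearr M g1)) p q"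
      "\<And>p q. 0 \<le> p \<Longrightarrow> p < q \<Longrightarrow> q \<le> b \<Longrightarrow> chord_gap_bounded D (primitive (decr_rearr M g2)) p q"
  shows "chord_gap_bounded D (primitive (decr_rearr M (\<lambda>x. g1 x + g2 x))) a b"
proof -
  interpret G1: bounded_nonneg M g1 K by (rule g1)
  interpret G2: bounded_nonneg M g2 K by (rule g2)
  interpret G: bounded_nonneg M "\<lambda>x. g1 x + g2 x" K by (rule g)
  have dist: "distribution_fun M (\<lambda>x. g1 x + g2 x) m = distribution_fun M g1 m + distribution_fun M g2 m"
    if "0 \<le> m" for m
  proof -
    have "{x \<in> space M. m < g1 x + g2 x} = {x \<in> space M. m < g1 x} \<union> {x \<in> space M. m < g2 x}"
      using disj G1.nonneg G2.nonneg by force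
    moreover have "{x \<in> space M. m < g1 x} \<inter> {x \<in> space M. m < g2 x} = {}"
      using disj that by force
    ultimately show ?thesis
      unfolding G.distribution_eq[OF that] G1.distribution_eq[OF that] G2.distribution_eq[OF that]
      by (simp add: plus_emeasure)
  qed
  have exc: "excess M (\<lambda>x. g1 x + g2 x) m = excess M g1 m + excess M g2 m" if "0 \<le> m" for m
  proof -
    have "excess M (\<lambda>x. g1 x + g2 x) m = (\<integral>\<^sup>+x. ennreal (g1 x - m) + ennreal (g2 x - m) \<partial>M)"
      unfolding excess_def using disj that by (intro nn_integral_cong) (force simp: ennreal_neg)
    also have "\<dots> = excess M g1 m + excess M g2 m"
      unfolding excess_def by (rule nn_integral_add) measurable
    finally show ?thesis .
  qed
  show ?thesis
  proof (rule chord_gap_bounded_supconvolution[OF G.F_concave _ G1.F_continuous _ G2.F_continuous _ _ D gap ab])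
    fix y z :: real assume yz: "0 \<le> y" "0 \<le> z"
    let ?\<beta> = "G.h (y + z)"
    have \<beta>: "0 \<le> ?\<beta>" by (rule G.rearr_nonneg)
    have "ennreal (G1.F y - ?\<beta> * y + (G2.F z - ?\<beta> * z)) \<le> ennreal (G1.F y - ?\<beta> * y) + ennreal (G2.F z - ?\<beta> * z)"
      by (rule ennreal_add_le)
    also have "\<dots> \<le> excess M g1 ?\<beta> + excess M g2 ?\<beta>"
      by (intro add_mono G1.F_le_excess G2.F_le_excess yz \<beta>)
    also have "\<dots> = ennreal (G.F (y + z) - ?\<beta> * (y + z))"
      using G.excess_at_rearr(1)[of "y + z"] yz exc[OF \<beta>] by simp
    finally have "G1.F y - ?\<beta> * y + (G2.F z - ?\<beta> * z) \<le> G.F (y + z) - ?\<beta> * (y + z)"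
      using G.excess_at_rearr(2)[of "y + z"] yz by (subst (asm) ennreal_le_iff) auto
    then show "G1.F y + G2.F z \<le> G.F (y + z)" by (simp add: algebra_simps)
  next
    fix x assume x: "a < x" "x < b" and pos: "0 < chord_gap G.F a b x"
    define m where "m = (G.F b - G.F a) / (b - a)"
    have mb: "m * (b - a) = G.F b - G.F a" using ab by (simp add: m_def)
    have m: "0 \<le> m" using G.F_mono[of a b] ab by (simp add: m_def)
    have "G.F b - m * (b - x) < G.F x"
      using pos mb by (simp add: chord_gap_def m_def[symmetric] algebra_simps)
    also have "G.F x \<le> G.F b + G.h b * (x - b)"
      by (rule G.F_supergradient) (use ab x in auto)
    finally have "(G.h b - m) * (b - x) < 0" by (simp add: algebra_simps)
    \<comment> \<open>The gap is positive somewhere, so at \<open>b\<close> the primitive grows more slowly than the chord.\<close>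
    then have "G.h b \<le> m" using x by (simp add: mult_less_0_iff)
    then have d: "distribution_fun M g1 m + distribution_fun M g2 m \<le> ennreal b"
      using G.rearr_le_iff[OF m] dist[OF m] by simp
    then have d': "distribution_fun M g1 m < \<infinity>" "distribution_fun M g2 m < \<infinity>"
      by (auto simp: top.not_eq_extremum[symmetric] top_unique)
    then obtain x1 x2 where x1: "distribution_fun M g1 m = ennreal x1" "0 \<le> x1"
      and x2: "distribution_fun M g2 m = ennreal x2" "0 \<le> x2"
      by (metis ennreal_cases infinity_ennreal_def less_irrefl)
    have "x1 + x2 \<le> b"
      using d x1 x2 ab by (simp add: ennreal_plus[symmetric] ennreal_le_iff del: ennreal_plus)
    moreover have "ennreal (G.F x - m * x) \<le> excess M g1 m + excess M g2 m"
      unfolding exc[OF m, symmetric] by (rule G.F_le_excess) (use x ab m in auto)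
    then have "G.F x - m * x \<le> (G1.F x1 - m * x1) + (G2.F x2 - m * x2)"
      using G1.excess_at_distribution[OF m x1] G2.excess_at_distribution[OF m x2]
      by (simp add: ennreal_plus[symmetric] ennreal_le_iff del: ennreal_plus)
    ultimately show "\<exists>x1 x2. 0 \<le> x1 \<and> 0 \<le> x2 \<and> x1 + x2 \<le> b \<and>
         G.F x - (G.F b - G.F a) / (b - a) * x \<le> G1.F x1 + G2.F x2 - (G.F b - G.F a) / (b - a) * (x1 + x2)"
      unfolding m_def[symmetric] using x1 x2
      by (intro exI[of _ x1] exI[of _ x2]) (simp add: algebra_simps)
  qed simp_all
qed

section \<open>Unbounded functions\<close>

lemma antimono_indicator_measurable:
  fixes h :: "real \<Rightarrow> real"
  assumes "antimono_on {0<..} h" "0 \<le> a"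
  shows "(\<lambda>s. indicator {a<..<T} s * h s) \<in> borel_measurable lebesgue"
proof (rule borel_measurable_lebesgueI)
  have "mono_on {0<..} (\<lambda>s. - h s)" using assms(1) by (auto simp: monotone_on_def)
  then have "(\<lambda>s. - h s) \<in> borel_measurable (restrict_space borel {0<..})"
    by (rule borel_measurable_mono_on_fnc)
  then have "(\<lambda>s. indicator {0<..} s *\<^sub>R (- h s)) \<in> borel_measurable borel"
    by (subst (asm) borel_measurable_restrict_space_iff) auto
  then have "(\<lambda>s. - (indicator {a<..<T} s * (indicator {0<..} s *\<^sub>R (- h s)))) \<in> borel_measurable borel"
    by measurable
  also have "(\<lambda>s. - (indicator {a<..<T} s * (indicator {0<..} s *\<^sub>R (- h s)))) = (\<lambda>s. indicator {a<..<T} s * h s)"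
    using assms(2) by (auto simp: indicator_def)
  finally show "(\<lambda>s. indicator {a<..<T} s * h s) \<in> borel_measurable borel" .
qed

lemma antimono_min:
  fixes h :: "real \<Rightarrow> real"
  shows "antimono_on S h \<Longrightarrow> antimono_on S (\<lambda>s. min (h s) k)"
  unfolding monotone_on_def by (meson min.mono order_refl)

lemma antimono_bounded_integrable:
  fixes h :: "real \<Rightarrow> real"
  assumes anti: "antimono_on {0<..} h" and nonneg: "\<And>s. 0 < s \<Longrightarrow> 0 \<le> h s"
    and ab: "0 \<le> a" and bd: "\<And>s. a < s \<Longrightarrow> h s \<le> k"
  shows "set_integrable lebesgue {a<..<T} h"
proof (rule set_integrable_bound[OF set_integrable_const_Ioo[of a T k]])
  show "set_borel_measurable lebesgue {a<..<T} h"
    using antimono_indicator_measurable[OF anti ab] by (simp add: set_borel_measurable_def)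
  show "AE s in lebesgue. s \<in> {a<..<T} \<longrightarrow> norm (h s) \<le> norm k"
    using nonneg bd ab by (intro AE_I2) force
qed

lemma truncation_tendsto:
  fixes y :: real
  shows "(\<lambda>n. min y (real n)) \<longlonglongrightarrow> y"
proof -
  obtain n0 where "y \<le> real n0" using real_arch_simple by blast
  then have "eventually (\<lambda>n. min y (real n) = y) sequentially"
    by (intro eventually_sequentiallyI[of n0]) linarith
  then show ?thesis by (rule tendsto_eventually)
qed

text \<open>The bound on the gap over the midpoint \<open>x\<close> of \<open>(0, b)\<close> compares the integral over \<open>(0, x)\<close> with
  the one over \<open>(x, b)\<close>. The latter is at most \<open>h x * (b - x)\<close>, whatever the height of the
  truncation, so monotone convergence bounds the former for \<open>h\<close> itself.\<close>

lemma integrable_of_truncated_chord_gaps: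
  fixes h :: "real \<Rightarrow> real"
  assumes anti: "antimono_on {0<..} h" and nonneg: "\<And>s. 0 < s \<Longrightarrow> 0 \<le> h s"
    and b: "0 < b"
    and gap: "\<And>n. chord_gap_bounded D (primitive (\<lambda>s. min (h s) (real n))) 0 b"
  shows "set_integrable lebesgue {0<..<T} h"
proof -
  define x where "x = b / 2"
  have x: "0 < x" "x < b" using b by (auto simp: x_def)
  let ?h = "\<lambda>n s. min (h s) (real n)"
  define C where "C = h x * (b - x) + D * b"
  have int: "set_integrable lebesgue {0<..<T} (?h n)" for n T
    by (rule antimono_bounded_integrable[OF antimono_min[OF anti], where k = "real n"]) (use nonneg in auto)
  have bound: "primitive (?h n) x \<le> C" for n
  proof -
    have "primitive (?h n) b - primitive (?h n) x \<le> h x * (b - x)"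
    proof (rule primitive_diff_le[OF int])
      show "?h n s \<le> h x" if "x < s" "s < b" for s
        using anti x that by (auto simp: monotone_on_def intro: min.coboundedI1)
    qed (use x in auto)
    moreover have "chord_gap (primitive (?h n)) 0 b x \<le> D / 2 * b"
      using gap[of n] x by (auto simp: chord_gap_bounded_def)
    moreover have "chord_gap (primitive (?h n)) 0 b x = primitive (?h n) x - primitive (?h n) b / 2"
      using b by (simp add: chord_gap_def x_def)
    ultimately show ?thesis by (simp add: C_def)
  qed
  have lim: "(\<lambda>n. \<integral>\<^sup>+s. ennreal (indicator {0<..<x} s * ?h n s) \<partial>lebesgue)
      \<longlonglongrightarrow> (\<integral>\<^sup>+s. ennreal (indicator {0<..<x} s * h s) \<partial>lebesgue)"
  proof (rule nn_integral_LIMSEQ)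
    show "incseq (\<lambda>n s. ennreal (indicator {0<..<x} s * ?h n s))"
      by (auto simp: incseq_def le_fun_def indicator_def intro!: ennreal_leI)
    show "(\<lambda>s. ennreal (indicator {0<..<x} s * ?h n s)) \<in> borel_measurable lebesgue" for n
      using antimono_indicator_measurable[OF antimono_min[OF anti] order_refl]
      by (rule measurable_compose) simp
    fix s
    show "(\<lambda>n. ennreal (indicator {0<..<x} s * ?h n s)) \<longlonglongrightarrow> ennreal (indicator {0<..<x} s * h s)"
      by (intro tendsto_intros tendsto_ennrealI truncation_tendsto)
  qed
  have "(\<integral>\<^sup>+s. ennreal (indicator {0<..<x} s * ?h n s) \<partial>lebesgue) \<le> ennreal C" for n
  proof -
    have "(\<integral>\<^sup>+s. ennreal (indicator {0<..<x} s * ?h n s) \<partial>lebesgue) = ennreal (primitive (?h n) x)"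
      unfolding primitive_def set_lebesgue_integral_def real_scaleR_def
      by (rule nn_integral_eq_integral) (use int nonneg in \<open>auto simp: set_integrable_def indicator_def\<close>)
    also have "\<dots> \<le> ennreal C" by (rule ennreal_leI[OF bound])
    finally show ?thesis .
  qed
  then have fin: "(\<integral>\<^sup>+s. ennreal (indicator {0<..<x} s * h s) \<partial>lebesgue) \<le> ennreal C"
    by (intro LIMSEQ_le_const2[OF lim]) auto
  have left: "set_integrable lebesgue {0<..<x} h"
    unfolding set_integrable_def real_scaleR_def
  proof (rule integrableI_nonneg)
    show "(\<lambda>s. indicator {0<..<x} s * h s) \<in> borel_measurable lebesgue"
      by (rule antimono_indicator_measurable[OF anti order_refl])
    show "(\<integral>\<^sup>+s. ennreal (indicator {0<..<x} s * h s) \<partial>lebesgue) < \<infinity>"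
      using fin by (rule le_less_trans) simp
  qed (use nonneg in \<open>auto simp: indicator_def\<close>)
  have right: "set_integrable lebesgue {x / 2<..<T} h"
    by (rule antimono_bounded_integrable[OF anti nonneg, of _ "h (x / 2)"])
       (use anti x in \<open>auto simp: monotone_on_def\<close>)
  have "set_integrable lebesgue ({0<..<x} \<union> {x / 2<..<T}) h"
    by (rule set_integrable_Un[OF left right]) auto
  then show ?thesis by (rule set_integrable_subset) (use x in auto)
qed

lemma primitive_truncation_tendsto:
  fixes h :: "real \<Rightarrow> real"
  assumes anti: "antimono_on {0<..} h" and nonneg: "\<And>s. 0 < s \<Longrightarrow> 0 \<le> h s"
    and int: "set_integrable lebesgue {0<..<t} h"
  shows "(\<lambda>n. primitive (\<lambda>s. min (h s) (real n)) t) \<longlonglongrightarrow> primitive h t"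
  unfolding primitive_def set_lebesgue_integral_def real_scaleR_def
proof (rule integral_dominated_convergence)
  show "(\<lambda>s. indicat_real {0<..<t} s * h s) \<in> borel_measurable lebesgue"
    by (rule antimono_indicator_measurable[OF anti order_refl])
  show "(\<lambda>s. indicat_real {0<..<t} s * min (h s) (real n)) \<in> borel_measurable lebesgue" for n
    by (rule antimono_indicator_measurable[OF antimono_min[OF anti] order_refl])
  show "integrable lebesgue (\<lambda>s. indicat_real {0<..<t} s * h s)"
    using int by (simp add: set_integrable_def)
  show "AE s in lebesgue. norm (indicat_real {0<..<t} s * min (h s) (real n)) \<le> indicat_real {0<..<t} s * h s" for n
    using nonneg by (intro AE_I2) (auto simp: indicator_def)
  show "AE s in lebesgue. (\<lambda>n. indicat_real {0<..<t} s * min (h s) (real n)) \<longlonglongrightarrow> indicat_real {0<..<t} s * h s"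
    by (intro AE_I2 tendsto_intros truncation_tendsto)
qed

lemma chord_gap_bounded_of_truncations:
  fixes h :: "real \<Rightarrow> real"
  assumes anti: "antimono_on {0<..} h" and nonneg: "\<And>s. 0 < s \<Longrightarrow> 0 \<le> h s"
    and int: "\<And>T. set_integrable lebesgue {0<..<T} h"
    and ab: "a < b"
    and gap: "\<And>n. chord_gap_bounded D (primitive (\<lambda>s. min (h s) (real n))) a b"
  shows "chord_gap_bounded D (primitive h) a b"
  unfolding chord_gap_bounded_def
proof
  fix x assume x: "x \<in> {a<..<b}"
  have "(\<lambda>n. chord_gap (primitive (\<lambda>s. min (h s) (real n))) a b x) \<longlonglongrightarrow> chord_gap (primitive h) a b x"
    unfolding chord_gap_def using ab
    by (intro tendsto_intros primitive_truncation_tendsto[OF anti nonneg int]) auto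
  then show "chord_gap (primitive h) a b x \<le> D / 2 * (b - a)"
    by (rule LIMSEQ_le_const2) (use gap x in \<open>auto simp: chord_gap_bounded_def\<close>)
qed

lemma rearrangeable_level:
  assumes "rearrangeable M f" "0 < s"
  obtains \<beta> where "0 \<le> \<beta>" "distribution_fun M f \<beta> \<le> ennreal s"
proof -
  have "(distribution_fun M f \<longlongrightarrow> 0) at_top" using assms(1) by (simp add: rearrangeable_def)
  then have "eventually (\<lambda>\<beta>. distribution_fun M f \<beta> < ennreal s) at_top"
    by (rule order_tendstoD) (use assms(2) in simp)
  then have "eventually (\<lambda>\<beta>. 0 \<le> \<beta> \<and> distribution_fun M f \<beta> < ennreal s) at_top"
    using eventually_ge_at_top[of 0] by eventually_elim auto
  then obtain \<beta> where "0 \<le> \<beta>" "distribution_fun M f \<beta> < ennreal s"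
    by (auto simp: eventually_at_top_linorder)
  then show ?thesis using that[of \<beta>] by simp
qed

lemma decr_rearr_rearrangeable:
  assumes f: "rearrangeable M f" and s: "0 < s"
  shows "0 \<le> decr_rearr M f s"
    and "0 \<le> \<alpha> \<Longrightarrow> decr_rearr M f s \<le> \<alpha> \<longleftrightarrow> distribution_fun M f \<alpha> \<le> ennreal s"
proof -
  obtain \<beta> where \<beta>: "0 \<le> \<beta>" "distribution_fun M f \<beta> \<le> ennreal s" using rearrangeable_level[OF f s] .
  show "0 \<le> decr_rearr M f s" by (rule decr_rearr_nonneg[OF \<beta>])
  show "0 \<le> \<alpha> \<Longrightarrow> decr_rearr M f s \<le> \<alpha> \<longleftrightarrow> distribution_fun M f \<alpha> \<le> ennreal s"
    by (rule decr_rearr_le_iff[OF _ \<beta>]) (use f in \<open>simp add: rearrangeable_def\<close>)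
qed

lemma decr_rearr_antimono:
  assumes f: "rearrangeable M f"
  shows "antimono_on {0<..} (decr_rearr M f)"
  unfolding monotone_on_def
proof safe
  fix s t :: real assume st: "0 < s" "s \<le> t"
  note r = decr_rearr_rearrangeable[OF f]
  have "distribution_fun M f (decr_rearr M f s) \<le> ennreal s" using r(2)[OF st(1) r(1)] st by blast
  also have "\<dots> \<le> ennreal t" using st by (intro ennreal_leI)
  finally show "decr_rearr M f t \<le> decr_rearr M f s" using r(2)[of t] r(1)[of s] st by simp
qed

lemma decr_rearr_truncate:
  assumes f: "rearrangeable M f" and s: "0 < s" and k: "0 \<le> k"
  shows "decr_rearr M (\<lambda>x. min \<bar>f x\<bar> k) s = min (decr_rearr M f s) k"
proof -
  have [measurable]: "f \<in> borel_measurable M" using f by (simp add: rearrangeable_def)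
  interpret T: bounded_nonneg M "\<lambda>x. min \<bar>f x\<bar> k" k
    by unfold_locales (use k in auto)
  note r = decr_rearr_rearrangeable[OF f s]
  have dist: "distribution_fun M (\<lambda>x. min \<bar>f x\<bar> k) \<alpha> = distribution_fun M f \<alpha>" if "0 \<le> \<alpha>" "\<alpha> < k" for \<alpha>
    unfolding T.distribution_eq[OF that(1)] using that
    by (simp add: distribution_fun_def)
  have "T.h s \<le> decr_rearr M f s"
  proof (cases "decr_rearr M f s < k")
    case True
    then show ?thesis using T.rearr_le_iff[OF r(1)] dist[OF r(1)] r(2)[OF r(1)] by simp
  next
    case False
    then show ?thesis using T.rearr_le[of s] by simp
  qed
  moreover have "decr_rearr M f s \<le> T.h s" if "T.h s < k"
    using T.rearr_le_iff[OF T.rearr_nonneg, of s s] dist[OF T.rearr_nonneg that] r(2)[OF T.rearr_nonneg] by simp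
  ultimately show ?thesis using T.rearr_le[of s] by (cases "T.h s < k") auto
qed

text \<open>The positive and the negative part of \<open>f\<close> are rearranged separately because the oscillation
  of \<open>|f|\<close> can be close to twice that of \<open>f\<close>, whereas truncations from above and from below do not
  increase it. The truncation at height \<open>n\<close> makes the functions bounded, as the
  decompositions require.\<close>

lemma chord_gap_bounded_rearrangement:
  assumes basis: "measure_basis M \<A>" and c: "0 \<le> c" and B: "0 \<le> B"
    and cz: "CZ_at_rearrangement_means M \<A> c"
    and f: "rearrangeable M f" and int: "integrable_on_sets M \<A> f"
    and osc: "\<And>A. A \<in> \<A> \<Longrightarrow> mean_osc M f A \<le> B"
    and ab: "0 \<le> a" "a < b" "ennreal b < emeasure M (space M)"
  shows "set_integrable lebesgue {0<..<T} (decr_rearr M f)"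
    and "chord_gap_bounded (c * B) (primitive (decr_rearr M f)) a b"
proof -
  have fm[measurable]: "f \<in> borel_measurable M" using f by (simp add: rearrangeable_def)
  note anti = decr_rearr_antimono[OF f] and nonneg = decr_rearr_rearrangeable(1)[OF f]
  have gap: "chord_gap_bounded (c * B) (primitive (\<lambda>s. min (decr_rearr M f s) (real n))) a b"
    if ab: "0 \<le> a" "a < b" "ennreal b < emeasure M (space M)" for a b n
  proof -
    define p where "p x = min (max (f x) 0) (real n)" for x
    define q where "q x = min (max (0 - f x) 0) (real n)" for x
    have loc: "bounded_nonneg M p (real n)" "bounded_nonneg M q (real n)"
      "bounded_nonneg M (\<lambda>x. p x + q x) (real n)"
      unfolding p_def q_def by (unfold_locales; (measurable | force))+
    have oscs: "mean_osc M p A \<le> B" "mean_osc M q A \<le> B" if A: "A \<in> \<A>" for A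
    proof -
      have A': "A \<in> sets M" "emeasure M A < \<infinity>" "0 < emeasure M A"
        using basis A by (auto simp: measure_basis_def)
      have i: "set_integrable M A f" using int A by (simp add: integrable_on_sets_def)
      have i': "set_integrable M A (\<lambda>x. 0 - f x)"
        by (rule set_integral_diff(1)[OF mean_deviation_zero(2)[OF A'(2,3,1) i] i])
      have clamp: "mean_osc M (\<lambda>x. min (max (u x) 0) (real n)) A \<le> mean_osc M u A"
        if u: "u \<in> borel_measurable M" "set_integrable M A u" for u
      proof -
        have "set_integrable M A (\<lambda>x. max (u x) 0)"
          by (rule set_integrable_max_const[OF u(1) A'(1,2) u(2)])
        then have "mean_osc M (\<lambda>x. min (max (u x) 0) (real n)) A \<le> mean_osc M (\<lambda>x. max (u x) 0) A"
          using u A' by (intro mean_osc_min_le) auto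
        also have "\<dots> \<le> mean_osc M u A" by (rule mean_osc_max_le[OF u(1) A' u(2)])
        finally show ?thesis .
      qed
      show "mean_osc M p A \<le> B" unfolding p_def using clamp[OF fm i] osc[OF A] by simp
      have "mean_osc M q A \<le> mean_osc M (\<lambda>x. 0 - f x) A" unfolding q_def by (rule clamp[OF _ i']) measurable
      also have "\<dots> = mean_osc M f A" by (rule mean_osc_const_minus[OF A' i])
      finally show "mean_osc M q A \<le> B" using osc[OF A] by simp
    qed
    have le: "ennreal q' < emeasure M (space M)" if "q' \<le> b" for q'
      using ennreal_leI[OF that] ab(3) by (rule le_less_trans)
    have "chord_gap_bounded (c * B) (primitive (decr_rearr M (\<lambda>x. p x + q x))) a b"
    proof (rule chord_gap_bounded_sum[OF loc _ _ ab(1,2)])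
      show "p x = 0 \<or> q x = 0" for x by (auto simp: p_def q_def)
      show "0 \<le> c * B" using c B by simp
      show "chord_gap_bounded (c * B) (primitive (decr_rearr M p)) r t" if "0 \<le> r" "r < t" "t \<le> b" for r t
        by (rule bounded_nonneg.chord_gap_bounded_nonneg[OF loc(1) basis c B oscs(1) cz that(1,2) le[OF that(3)]])
      show "chord_gap_bounded (c * B) (primitive (decr_rearr M q)) r t" if "0 \<le> r" "r < t" "t \<le> b" for r t
        by (rule bounded_nonneg.chord_gap_bounded_nonneg[OF loc(2) basis c B oscs(2) cz that(1,2) le[OF that(3)]])
    qed
    moreover have "(\<lambda>x. p x + q x) = (\<lambda>x. min \<bar>f x\<bar> (real n))"
      by (auto simp: p_def q_def fun_eq_iff)
    moreover have "primitive (decr_rearr M (\<lambda>x. min \<bar>f x\<bar> (real n))) = primitive (\<lambda>s. min (decr_rearr M f s) (real n))"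
      unfolding primitive_def
      by (intro ext set_lebesgue_integral_cong) (auto simp: decr_rearr_truncate[OF f])
    ultimately show ?thesis by simp
  qed
  show i: "set_integrable lebesgue {0<..<T} (decr_rearr M f)" for T
    by (rule integrable_of_truncated_chord_gaps[OF anti nonneg _ gap, of b]) (use ab in auto)
  show "chord_gap_bounded (c * B) (primitive (decr_rearr M f)) a b"
    by (rule chord_gap_bounded_of_truncations[OF anti nonneg i ab(2) gap[OF ab]])
qed

lemma set_integral_lebesgue_on:
  fixes f :: "real \<Rightarrow> real"
  assumes "R \<in> sets lebesgue" "S \<subseteq> R"
  shows "set_integrable (lebesgue_on R) S f \<longleftrightarrow> set_integrable lebesgue S f"
    and "(LINT x:S|lebesgue_on R. f x) = (LINT x:S|lebesgue. f x)"
proof -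
  have eq: "(\<lambda>x. indicat_real R x * (indicat_real S x * f x)) = (\<lambda>x. indicat_real S x * f x)"
    using assms(2) by (auto simp: indicator_def fun_eq_iff)
  show "set_integrable (lebesgue_on R) S f \<longleftrightarrow> set_integrable lebesgue S f"
    unfolding set_integrable_def using assms(1) by (subst integrable_restrict_space) (auto simp: eq)
  show "(LINT x:S|lebesgue_on R. f x) = (LINT x:S|lebesgue. f x)"
    unfolding set_lebesgue_integral_def using assms(1) by (subst integral_restrict_space) (auto simp: eq)
qed

section \<open>Mean oscillation of the rearrangement\<close>

theorem theorem4p4:
  fixes M :: "'a measure" and \<A> :: "'a set set" and c :: real and f :: "'a \<Rightarrow> real"
  assumes "semi_finite M"
    and "nontrivial_measure M"
    and "measure_basis M \<A>"
    and "c \<ge> 1"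
    and "\<And>(g :: 'a \<Rightarrow> real) (t :: real) (\<gamma> :: real).
           g \<in> L_infinity M \<Longrightarrow> (\<forall>x\<in>space M. 0 \<le> g x) \<Longrightarrow>
           0 < t \<Longrightarrow> ennreal t < emeasure M (space M) \<Longrightarrow>
           \<gamma> = 1 / t * (LINT s:{0<..<t}|lebesgue. decr_rearr M g s) \<Longrightarrow> \<gamma> > 0 \<Longrightarrow>
           admits_CZ_decomposition M \<A> c g \<gamma>"
    and "f \<in> BMO M \<A>"
    and "rearrangeable M f"
  shows "integrable_on_sets (lebesgue_on (rearr_dom M))
             (bounded_open_subintervals (rearr_dom M)) (decr_rearr M f) \<and>
         bmo_seminorm (lebesgue_on (rearr_dom M))
             (bounded_open_subintervals (rearr_dom M)) (decr_rearr M f)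
           \<le> ennreal c * bmo_seminorm M \<A> f"
proof -
  let ?R = "rearr_dom M" and ?h = "decr_rearr M f"
  note basis = assms(3) and rearr = assms(7)
  have c: "0 \<le> c" using assms(4) by simp
  have cz: "CZ_at_rearrangement_means M \<A> c"
    unfolding CZ_at_rearrangement_means_def primitive_def using assms(5) by simp
  have int: "integrable_on_sets M \<A> f" using assms(6) by (simp add: BMO_def)
  obtain B where B: "0 \<le> B" "bmo_seminorm M \<A> f = ennreal B"
    using assms(6) by (cases "bmo_seminorm M \<A> f" rule: ennreal_cases) (auto simp: BMO_def)
  have osc: "mean_osc M f A \<le> B" if "A \<in> \<A>" for A
  proof -
    have "ennreal (mean_osc M f A) \<le> ennreal B"
      using that unfolding B(2)[symmetric] bmo_seminorm_def by (rule SUP_upper)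
    then show ?thesis using B(1) by (simp add: ennreal_le_iff)
  qed
  note gap = chord_gap_bounded_rearrangement[OF basis c B(1) cz rearr int osc]
  have "?R \<in> sets borel" unfolding rearr_dom_def by measurable
  then have R: "?R \<in> sets lebesgue" by (simp add: sets_completionI_sets)
  have interval: "set_integrable (lebesgue_on ?R) I ?h \<and> mean_osc (lebesgue_on ?R) ?h I \<le> c * B"
    if I: "I \<in> bounded_open_subintervals ?R" for I
  proof -
    obtain a b where ab: "a < b" and I_eq: "I = {a<..<b}" and sub: "I \<subseteq> ?R"
      using I by (auto simp: bounded_open_subintervals_def)
    have t: "0 < t" "ennreal t < emeasure M (space M)" if "a < t" "t < b" for t
      using sub that by (auto simp: I_eq rearr_dom_def)
    have a: "0 \<le> a"
    proof (rule ccontr)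
      assume "\<not> 0 \<le> a"
      then have "a < (a + min 0 b) / 2" "(a + min 0 b) / 2 < b" "(a + min 0 b) / 2 < 0"
        using ab by (auto simp: min_def)
      with t(1) show False by fastforce
    qed
    obtain t0 where "a < t0" "t0 < b" using ab dense by blast
    then have i: "set_integrable lebesgue {0<..<T} ?h" for T
      using gap(1)[of 0 t0] t a by simp
    have "chord_gap_bounded (c * B) (primitive ?h) a b"
      by (rule chord_gap_bounded_left_limit[OF primitive_continuous[OF i] a ab]) (use gap(2) a t in blast)
    moreover have "mean_on (lebesgue_on ?R) ?h I = (LINT s:{a<..<b}|lebesgue. ?h s) / (b - a)"
      and meas: "measure (lebesgue_on ?R) I = b - a"
      using R sub ab unfolding I_eq by (simp_all add: mean_on_def set_integral_lebesgue_on measure_restrict_space)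
    ultimately have "(LINT s:I|lebesgue_on ?R. \<bar>?h s - mean_on (lebesgue_on ?R) ?h I\<bar>) \<le> c * B * (b - a)"
      unfolding set_integral_lebesgue_on(2)[OF R sub] unfolding I_eq
      using c B(1) by (intro mean_deviation_le[OF decr_rearr_antimono[OF rearr] i a ab]) auto
    then have "mean_osc (lebesgue_on ?R) ?h I \<le> c * B"
      unfolding mean_osc_def meas using ab by (simp add: field_simps)
    moreover have "set_integrable (lebesgue_on ?R) I ?h"
      unfolding set_integral_lebesgue_on(1)[OF R sub] unfolding I_eq
      by (rule set_integrable_subset[OF i[of b]]) (use a in auto)
    ultimately show ?thesis by simp
  qed
  have "bmo_seminorm (lebesgue_on ?R) (bounded_open_subintervals ?R) ?h \<le> ennreal (c * B)"
    unfolding bmo_seminorm_def by (intro SUP_least ennreal_leI) (use interval in blast)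
  moreover have "ennreal (c * B) = ennreal c * bmo_seminorm M \<A> f"
    using c B by (simp add: ennreal_mult)
  ultimately show ?thesis using interval by (simp add: integrable_on_sets_def)
qed

end
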